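(* For any $\mathbb{T}$-Poisson CGL extension $R$ of length $n$, the GSV Equations $$\mathbf{q}M=-\Lambda\quad\text{and}\quad\chi_{\mathbf y}M=0$$ for $R$ have a solution $M\in\mathrm{Mat}_{n\times\mathrm{ex}}(\mathbf{k})$ if and only if $\chi_{\mathbf x}\boldsymbol\nu^{-1}E\Lambda=0$, and in such a case the solution is unique and is given by $M=E^t\boldsymbol\nu^{-1}E\Lambda$.
   Context: $\mathbf{k}$ is a field of characteristic $0$, $\mathbf{k}^\times=\mathbf{k}\setminus\{0\}$; $\mathbb{T}$ is a split $\mathbf{k}$-torus with Lie algebra $\mathfrak{t}$ and character lattice $X(\mathbb{T})\subset\mathfrak{t}^*$ (characters identified with differentials). $[a,b]$ is the set of integers between $a$ and $b$. Vectors are columns, standard basis $e_1,\dots,e_n$, $e_{\pm\infty}:=0$. $\mathrm{Mat}_{I\times J}$: rows indexed by $I$, columns by $J$ ($n$ means $[1,n]$). Products of a row of elements of $X(\mathbb{T})$ with a matrix over $\mathbf{k}$ are taken in $\mathfrak{t}^*$. CGL extension. A $\mathbb{T}$-Poisson CGL extension of length $n$ is a polynomial algebra $R=\mathbf{k}[x_1,\dots,x_n]$ with a $\mathbb{T}$-action by algebra automorphisms and a $\mathbb{T}$-invariant Poisson bracket such that each $x_j$ is a weight vector of weight $\chi_j\in X(\mathbb{T})$, and there are $h_1,\dots,h_n\in\mathfrak t$ with $\lambda_j:=\chi_j(h_j)\in\mathbf{k}^\times$ and $\{x_i,x_j\}=-\chi_i(h_j)x_ix_j-\delta_j(x_i)$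 for $i<j$, where $\delta_j$ is a locally nilpotent derivation of $\mathbf{k}[x_1,\dots,x_{j-1}]$ ($\delta_1=0$). Homogeneous Poisson primes (Goodearl–Yakimov). With $R_k=\mathbf{k}[x_1,\dots,x_k]$: $y_1=x_1$, $p(1)=-\infty$; for $k\ge2$, if $\delta_k=0$ then $p(k)=-\infty$, $y_k=x_k$; otherwise $p(k)\in[1,k-1]$ is the unique index such that $y_{p(k)}$ is a homogeneous ($\mathbb{T}$-weight vector) Poisson prime element of $R_{k-1}$ (prime with $\{y,R_{k-1}\}\subset yR_{k-1}$) and $\delta_k(y_{p(k)})\ne0$, and $y_k=y_{p(k)}x_k-\delta_k(y_{p(k)})/\lambda_k$. Successor map: $s(j)=k$ if $p(k)=j$, and $s(j)=+\infty$ if there is no such $k$. Each $y_j$ is a $\mathbb{T}$-weight vector (weight $\chi_{y_j}$) and $\{y_i,y_j\}=q_{i,j}y_iy_j$ with $q_{i,j}\in\mathbf{k}$. It is known that $\mathbf{q}=F\boldsymbol\lambda F^t$ and $\chi_{\mathbf y}=\chi_{\mathbf x}F^t$, where $F=E^{-1}$ and $\boldsymbol\lambda$ is the skew-symmetric matrix with $(i,j)$-entry $-\chi_i(h_j)$ for $i<j$. Matrices. $\mathbf{q}=(q_{i,j})$; $\chi_{\mathbf x}=(\chi_1,\dots,\chi_n)$; $\chi_{\mathbf y}=(\chi_{y_1},\dots,\chi_{y_n})$; $\mathrm{ex}=\{j:s(j)\ne+\infty\}$; $\Lambda\in\mathrm{Mat}_{n\times\mathrm{ex}}(\mathbf{k})$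 has $j$-th column $\lambda_{s(j)}e_j$; $E$ is $n\times n$ with $j$-th column $e_j-e_{s(j)}$; $\boldsymbol\nu$ is upper triangular with diagonal entries $\lambda_j$ and $(i,j)$-entry $\chi_i(h_j)+\chi_j(h_i)$ for $i<j$. *)

theory Defs
  imports Main "HOL-Library.Poly_Mapping"
begin

section \<open>Polynomial algebras\<close>

text \<open>
  An element of \<open>'k mpoly\<close> is a polynomial in indeterminates \<open>x\<^sub>0, x\<^sub>1, x\<^sub>2, \<dots>\<close>: a finitely
  supported family of coefficients, indexed by finitely supported exponent vectors.
  The algebra \<open>R\<^sub>k = k[x\<^sub>1, \<dots>, x\<^sub>k]\<close> is the subset \<open>polys k\<close>; \<open>x\<^sub>0\<close> is never used.
\<close>

type_synonym 'k mpoly = "(nat \<Rightarrow>\<^sub>0 nat) \<Rightarrow>\<^sub>0 'k"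

definition scalar :: "'k::field_char_0 \<Rightarrow> 'k mpoly" where
  "scalar c = Poly_Mapping.single 0 c"

definition var :: "nat \<Rightarrow> 'k::field_char_0 mpoly" where
  "var i = Poly_Mapping.single (Poly_Mapping.single i 1) 1"

definition polys :: "nat \<Rightarrow> 'k::field_char_0 mpoly set" where
  "polys k = {f. \<forall>m \<in> Poly_Mapping.keys f. Poly_Mapping.keys m \<subseteq> {1..k}}"

definition derivation_on :: "'k::field_char_0 mpoly set \<Rightarrow> ('k mpoly \<Rightarrow> 'k mpoly) \<Rightarrow> bool" where
  "derivation_on S d \<longleftrightarrow>
     (\<forall>f\<in>S. d f \<in> S) \<and>
     (\<forall>f\<in>S. \<forall>g\<in>S. d (f + g) = d f + d g) \<and>
     (\<forall>c. \<forall>f\<in>S. d (scalar c * f) = scalar c * d f) \<and>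
     (\<forall>f\<in>S. \<forall>g\<in>S. d (f * g) = d f * g + f * d g)"

definition locally_nilpotent_on ::
    "'k::field_char_0 mpoly set \<Rightarrow> ('k mpoly \<Rightarrow> 'k mpoly) \<Rightarrow> bool" where
  "locally_nilpotent_on S d \<longleftrightarrow> (\<forall>f\<in>S. \<exists>m. (d ^^ m) f = 0)"

definition poisson_bracket_on ::
    "'k::field_char_0 mpoly set \<Rightarrow> ('k mpoly \<Rightarrow> 'k mpoly \<Rightarrow> 'k mpoly) \<Rightarrow> bool" where
  "poisson_bracket_on S br \<longleftrightarrow>
     (\<forall>f\<in>S. derivation_on S (br f)) \<and>
     (\<forall>f\<in>S. \<forall>g\<in>S. br f g = - br g f) \<and>
     (\<forall>f\<in>S. \<forall>g\<in>S. \<forall>k\<in>S. br f (br g k) + br g (br k f) + br k (br f g) = 0)"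

definition algebra_endomorphism_on ::
    "'k::field_char_0 mpoly set \<Rightarrow> ('k mpoly \<Rightarrow> 'k mpoly) \<Rightarrow> bool" where
  "algebra_endomorphism_on S \<phi> \<longleftrightarrow>
     (\<forall>f\<in>S. \<phi> f \<in> S) \<and>
     (\<forall>c. \<phi> (scalar c) = scalar c) \<and>
     (\<forall>f\<in>S. \<forall>g\<in>S. \<phi> (f + g) = \<phi> f + \<phi> g) \<and>
     (\<forall>f\<in>S. \<forall>g\<in>S. \<phi> (f * g) = \<phi> f * \<phi> g)"

definition prime_element_in :: "'k::field_char_0 mpoly set \<Rightarrow> 'k mpoly \<Rightarrow> bool" where
  "prime_element_in S f \<longleftrightarrow>
     f \<in> S \<and> f \<noteq> 0 \<and> \<not> (\<exists>g\<in>S. f * g = 1) \<and>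
     (\<forall>a\<in>S. \<forall>b\<in>S. (\<exists>c\<in>S. a * b = f * c) \<longrightarrow> (\<exists>c\<in>S. a = f * c) \<or> (\<exists>c\<in>S. b = f * c))"

definition poisson_prime_in ::
    "'k::field_char_0 mpoly set \<Rightarrow> ('k mpoly \<Rightarrow> 'k mpoly \<Rightarrow> 'k mpoly) \<Rightarrow> 'k mpoly \<Rightarrow> bool" where
  "poisson_prime_in S br f \<longleftrightarrow>
     prime_element_in S f \<and> (\<forall>g\<in>S. \<exists>c\<in>S. br f g = f * c)"


section \<open>The split torus of rank r\<close>

text \<open>
  The torus is \<open>(k\<^sup>\<times>)\<^sup>r\<close>, its Lie algebra is \<open>k\<^sup>r\<close> and its character lattice is \<open>\<int>\<^sup>r\<close>; families
  indexed by \<open>{1..r}\<close> are padded outside the index set by the neutral element, so that each object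
  has exactly one representative.
\<close>

definition torus :: "nat \<Rightarrow> (nat \<Rightarrow> 'k::field_char_0) set" where
  "torus r = {t. (\<forall>i\<in>{1..r}. t i \<noteq> 0) \<and> (\<forall>i. i \<notin> {1..r} \<longrightarrow> t i = 1)}"

definition lie_algebra :: "nat \<Rightarrow> (nat \<Rightarrow> 'k::field_char_0) set" where
  "lie_algebra r = {h. \<forall>i. i \<notin> {1..r} \<longrightarrow> h i = 0}"

definition characters :: "nat \<Rightarrow> (nat \<Rightarrow> int) set" where
  "characters r = {\<chi>. \<forall>i. i \<notin> {1..r} \<longrightarrow> \<chi> i = 0}"

definition char_eval :: "nat \<Rightarrow> (nat \<Rightarrow> int) \<Rightarrow> (nat \<Rightarrow> 'k::field_char_0) \<Rightarrow> 'k" where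
  "char_eval r \<chi> t = (\<Prod>i\<in>{1..r}. t i powi \<chi> i)"

text \<open>The differential at \<open>1\<close> of the character \<open>t \<mapsto> \<Prod>\<^sub>i t\<^sub>i powi \<chi>\<^sub>i\<close>, a linear functional on the
  Lie algebra.\<close>

definition differential :: "nat \<Rightarrow> (nat \<Rightarrow> int) \<Rightarrow> (nat \<Rightarrow> 'k::field_char_0) \<Rightarrow> 'k" where
  "differential r \<chi> h = (\<Sum>i\<in>{1..r}. of_int (\<chi> i) * h i)"

definition weight_vector ::
    "nat \<Rightarrow> ((nat \<Rightarrow> 'k::field_char_0) \<Rightarrow> 'k mpoly \<Rightarrow> 'k mpoly) \<Rightarrow> (nat \<Rightarrow> int) \<Rightarrow> 'k mpoly \<Rightarrow> bool" where
  "weight_vector r act \<chi> f \<longleftrightarrow>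
     f \<noteq> 0 \<and> \<chi> \<in> characters r \<and> (\<forall>t\<in>torus r. act t f = scalar (char_eval r \<chi> t) * f)"


section \<open>Poisson CGL extensions\<close>

text \<open>
  \<open>act\<close> is the torus action, \<open>br\<close> the bracket, \<open>\<chi> j\<close> the weight of \<open>x\<^sub>j\<close>, and \<open>h j\<close>, \<open>\<delta> j\<close> are the
  element of the Lie algebra and the derivation of \<open>R\<^sub>j\<^sub>-\<^sub>1\<close> attached to \<open>x\<^sub>j\<close>. All functions are
  constrained only on the relevant subalgebras.
\<close>

locale poisson_cgl_extension =
  fixes n r :: nat
    and act :: "(nat \<Rightarrow> 'k::field_char_0) \<Rightarrow> 'k mpoly \<Rightarrow> 'k mpoly"
    and br :: "'k mpoly \<Rightarrow> 'k mpoly \<Rightarrow> 'k mpoly"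
    and \<chi> :: "nat \<Rightarrow> nat \<Rightarrow> int"
    and h :: "nat \<Rightarrow> nat \<Rightarrow> 'k"
    and \<delta> :: "nat \<Rightarrow> 'k mpoly \<Rightarrow> 'k mpoly"
  assumes act_endo: "t \<in> torus r \<Longrightarrow> algebra_endomorphism_on (polys n) (act t)"
    and act_one: "f \<in> polys n \<Longrightarrow> act (\<lambda>_. 1) f = f"
    and act_mult: "t \<in> torus r \<Longrightarrow> u \<in> torus r \<Longrightarrow> f \<in> polys n \<Longrightarrow>
          act (\<lambda>i. t i * u i) f = act t (act u f)"
    and bracket: "poisson_bracket_on (polys n) br"
    and bracket_invariant: "t \<in> torus r \<Longrightarrow> f \<in> polys n \<Longrightarrow> g \<in> polys n \<Longrightarrow>
          act t (br f g) = br (act t f) (act t g)"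
    and var_weight: "j \<in> {1..n} \<Longrightarrow> weight_vector r act (\<chi> j) (var j)"
    and h_lie: "j \<in> {1..n} \<Longrightarrow> h j \<in> lie_algebra r"
    and lam_nonzero: "j \<in> {1..n} \<Longrightarrow> differential r (\<chi> j) (h j) \<noteq> 0"
    and \<delta>_derivation: "j \<in> {1..n} \<Longrightarrow> derivation_on (polys (j - 1)) (\<delta> j)"
    and \<delta>_nilpotent: "j \<in> {1..n} \<Longrightarrow> locally_nilpotent_on (polys (j - 1)) (\<delta> j)"
    and \<delta>_1: "n \<ge> 1 \<Longrightarrow> f \<in> polys 0 \<Longrightarrow> \<delta> 1 f = 0"
    and bracket_vars: "1 \<le> i \<Longrightarrow> i < j \<Longrightarrow> j \<le> n \<Longrightarrow>
          br (var i) (var j) =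
            - scalar (differential r (\<chi> i) (h j)) * var i * var j - \<delta> j (var i)"

definition lam :: "nat \<Rightarrow> (nat \<Rightarrow> nat \<Rightarrow> int) \<Rightarrow> (nat \<Rightarrow> nat \<Rightarrow> 'k::field_char_0) \<Rightarrow> nat \<Rightarrow> 'k" where
  "lam r \<chi> h j = differential r (\<chi> j) (h j)"


section \<open>The sequence of homogeneous Poisson primes\<close>

text \<open>
  The index \<open>j\<close> can serve as \<open>p(k)\<close> when \<open>\<delta>\<^sub>k \<noteq> 0\<close>: \<open>y\<^sub>j\<close> is a homogeneous Poisson prime element of
  \<open>R\<^sub>k\<^sub>-\<^sub>1\<close> which is not annihilated by \<open>\<delta>\<^sub>k\<close>.
\<close>

definition predecessor_candidate ::
    "nat \<Rightarrow> ((nat \<Rightarrow> 'k::field_char_0) \<Rightarrow> 'k mpoly \<Rightarrow> 'k mpoly) \<Rightarrow> ('k mpoly \<Rightarrow> 'k mpoly \<Rightarrow> 'k mpoly) \<Rightarrow>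
     (nat \<Rightarrow> 'k mpoly \<Rightarrow> 'k mpoly) \<Rightarrow> (nat \<Rightarrow> 'k mpoly) \<Rightarrow> nat \<Rightarrow> nat \<Rightarrow> bool" where
  "predecessor_candidate r act br \<delta> y k j \<longleftrightarrow>
     j \<in> {1..k - 1} \<and> (\<exists>\<psi>. weight_vector r act \<psi> (y j)) \<and>
     poisson_prime_in (polys (k - 1)) br (y j) \<and> \<delta> k (y j) \<noteq> 0"

text \<open>
  The recursive definition of \<open>p\<close> and \<open>y\<close>, as a property of the pair; it determines both on
  \<open>{1..n}\<close>, and a theorem of Goodearl and Yakimov says that a pair with this property exists for every
  Poisson CGL extension. The value \<open>None\<close> of \<open>p\<close> stands for \<open>-\<infinity>\<close>. Since \<open>\<delta>\<^sub>1 = 0\<close>, the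
  clause for \<open>y\<^sub>1\<close> is an instance of the one for \<open>\<delta>\<^sub>k = 0\<close>.
\<close>

definition homogeneous_poisson_primes ::
    "nat \<Rightarrow> nat \<Rightarrow> ((nat \<Rightarrow> 'k::field_char_0) \<Rightarrow> 'k mpoly \<Rightarrow> 'k mpoly) \<Rightarrow>
     ('k mpoly \<Rightarrow> 'k mpoly \<Rightarrow> 'k mpoly) \<Rightarrow> (nat \<Rightarrow> nat \<Rightarrow> int) \<Rightarrow> (nat \<Rightarrow> nat \<Rightarrow> 'k) \<Rightarrow>
     (nat \<Rightarrow> 'k mpoly \<Rightarrow> 'k mpoly) \<Rightarrow> (nat \<Rightarrow> nat option) \<Rightarrow> (nat \<Rightarrow> 'k mpoly) \<Rightarrow> bool" where
  "homogeneous_poisson_primes n r act br \<chi> h \<delta> p y \<longleftrightarrow>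
     (\<forall>k\<in>{1..n}.
        if \<forall>f\<in>polys (k - 1). \<delta> k f = 0
        then p k = None \<and> y k = var k
        else \<exists>j. p k = Some j \<and>
               (\<forall>i. predecessor_candidate r act br \<delta> y k i \<longleftrightarrow> i = j) \<and>
               y k = y j * var k - scalar (inverse (lam r \<chi> h k)) * \<delta> k (y j))"

text \<open>\<open>None\<close> stands for \<open>+\<infinity>\<close>.\<close>

definition successor :: "nat \<Rightarrow> (nat \<Rightarrow> nat option) \<Rightarrow> nat \<Rightarrow> nat option" where
  "successor n p j =
     (if \<exists>k\<in>{1..n}. p k = Some j then Some (THE k. k \<in> {1..n} \<and> p k = Some j) else None)"

definition exchangeable :: "nat \<Rightarrow> (nat \<Rightarrow> nat option) \<Rightarrow> nat set" where
  "exchangeable n p = {j \<in> {1..n}. successor n p j \<noteq> None}"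


section \<open>Matrices with rows and columns indexed by sets\<close>

definition Mat :: "nat set \<Rightarrow> nat set \<Rightarrow> (nat \<Rightarrow> nat \<Rightarrow> 'k::field_char_0) set" where
  "Mat I J = {A. \<forall>i j. \<not> (i \<in> I \<and> j \<in> J) \<longrightarrow> A i j = 0}"

text \<open>\<open>mat_mult J A B\<close> is the product of \<open>A \<in> Mat I J\<close> and \<open>B \<in> Mat J K\<close>.\<close>

definition mat_mult ::
    "nat set \<Rightarrow> (nat \<Rightarrow> nat \<Rightarrow> 'k::field_char_0) \<Rightarrow> (nat \<Rightarrow> nat \<Rightarrow> 'k) \<Rightarrow> nat \<Rightarrow> nat \<Rightarrow> 'k" where
  "mat_mult J A B = (\<lambda>i k. \<Sum>j\<in>J. A i j * B j k)"

definition mat_transpose :: "(nat \<Rightarrow> nat \<Rightarrow> 'k::field_char_0) \<Rightarrow> nat \<Rightarrow> nat \<Rightarrow> 'k" where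
  "mat_transpose A = (\<lambda>i j. A j i)"

definition mat_uminus :: "(nat \<Rightarrow> nat \<Rightarrow> 'k::field_char_0) \<Rightarrow> nat \<Rightarrow> nat \<Rightarrow> 'k" where
  "mat_uminus A = (\<lambda>i j. - A i j)"

definition mat_one :: "nat set \<Rightarrow> nat \<Rightarrow> nat \<Rightarrow> 'k::field_char_0" where
  "mat_one I = (\<lambda>i j. if i \<in> I \<and> i = j then 1 else 0)"

definition mat_inverse :: "nat set \<Rightarrow> (nat \<Rightarrow> nat \<Rightarrow> 'k::field_char_0) \<Rightarrow> nat \<Rightarrow> nat \<Rightarrow> 'k" where
  "mat_inverse I A =
     (THE B. B \<in> Mat I I \<and> mat_mult I A B = mat_one I \<and> mat_mult I B A = mat_one I)"

text \<open>The product of a row of characters with a matrix, a row of linear functionals on the Lie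
  algebra.\<close>

definition char_row_mult ::
    "nat \<Rightarrow> nat set \<Rightarrow> (nat \<Rightarrow> nat \<Rightarrow> int) \<Rightarrow> (nat \<Rightarrow> nat \<Rightarrow> 'k::field_char_0) \<Rightarrow> nat \<Rightarrow> (nat \<Rightarrow> 'k) \<Rightarrow> 'k" where
  "char_row_mult r I \<chi> A = (\<lambda>j h. \<Sum>i\<in>I. differential r (\<chi> i) h * A i j)"

definition char_row_mult_eq_0 ::
    "nat \<Rightarrow> nat set \<Rightarrow> nat set \<Rightarrow> (nat \<Rightarrow> nat \<Rightarrow> int) \<Rightarrow> (nat \<Rightarrow> nat \<Rightarrow> 'k::field_char_0) \<Rightarrow> bool" where
  "char_row_mult_eq_0 r I J \<chi> A \<longleftrightarrow> (\<forall>j\<in>J. \<forall>h\<in>lie_algebra r. char_row_mult r I \<chi> A j h = 0)"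


section \<open>The matrices of the GSV equations\<close>

definition Lam_mat ::
    "nat \<Rightarrow> nat \<Rightarrow> (nat \<Rightarrow> nat \<Rightarrow> int) \<Rightarrow> (nat \<Rightarrow> nat \<Rightarrow> 'k::field_char_0) \<Rightarrow> (nat \<Rightarrow> nat option) \<Rightarrow>
     nat \<Rightarrow> nat \<Rightarrow> 'k" where
  "Lam_mat n r \<chi> h p =
     (\<lambda>i j. if j \<in> exchangeable n p \<and> i = j then lam r \<chi> h (the (successor n p j)) else 0)"

definition E_mat :: "nat \<Rightarrow> (nat \<Rightarrow> nat option) \<Rightarrow> nat \<Rightarrow> nat \<Rightarrow> 'k::field_char_0" where
  "E_mat n p =
     (\<lambda>i j. if i \<in> {1..n} \<and> j \<in> {1..n}
            then (if i = j then 1 else 0) - (if successor n p j = Some i then 1 else 0)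
            else 0)"

definition nu_mat ::
    "nat \<Rightarrow> nat \<Rightarrow> (nat \<Rightarrow> nat \<Rightarrow> int) \<Rightarrow> (nat \<Rightarrow> nat \<Rightarrow> 'k::field_char_0) \<Rightarrow> nat \<Rightarrow> nat \<Rightarrow> 'k" where
  "nu_mat n r \<chi> h =
     (\<lambda>i j. if i \<in> {1..n} \<and> j \<in> {1..n}
            then (if i = j then lam r \<chi> h j
                  else if i < j then differential r (\<chi> i) (h j) + differential r (\<chi> j) (h i)
                  else 0)
            else 0)"

definition nu_inv_E_Lam ::
    "nat \<Rightarrow> nat \<Rightarrow> (nat \<Rightarrow> nat \<Rightarrow> int) \<Rightarrow> (nat \<Rightarrow> nat \<Rightarrow> 'k::field_char_0) \<Rightarrow> (nat \<Rightarrow> nat option) \<Rightarrow>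
     nat \<Rightarrow> nat \<Rightarrow> 'k" where
  "nu_inv_E_Lam n r \<chi> h p =
     mat_mult {1..n} (mat_inverse {1..n} (nu_mat n r \<chi> h))
       (mat_mult {1..n} (E_mat n p) (Lam_mat n r \<chi> h p))"

text \<open>As the \<open>y\<^sub>j\<close> are nonzero, \<open>q\<close> and the weights \<open>\<chi>y\<close> are determined by the following two
  properties (\<open>\<chi>y\<close> on \<open>{1..n}\<close>).\<close>

definition bracket_matrix ::
    "nat \<Rightarrow> ('k::field_char_0 mpoly \<Rightarrow> 'k mpoly \<Rightarrow> 'k mpoly) \<Rightarrow> (nat \<Rightarrow> 'k mpoly) \<Rightarrow>
     (nat \<Rightarrow> nat \<Rightarrow> 'k) \<Rightarrow> bool" where
  "bracket_matrix n br y q \<longleftrightarrow>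
     q \<in> Mat {1..n} {1..n} \<and>
     (\<forall>i\<in>{1..n}. \<forall>j\<in>{1..n}. br (y i) (y j) = scalar (q i j) * y i * y j)"

definition weights_of ::
    "nat \<Rightarrow> nat \<Rightarrow> ((nat \<Rightarrow> 'k::field_char_0) \<Rightarrow> 'k mpoly \<Rightarrow> 'k mpoly) \<Rightarrow> (nat \<Rightarrow> 'k mpoly) \<Rightarrow>
     (nat \<Rightarrow> nat \<Rightarrow> int) \<Rightarrow> bool" where
  "weights_of n r act y \<chi>y \<longleftrightarrow> (\<forall>j\<in>{1..n}. weight_vector r act (\<chi>y j) (y j))"

definition GSV_solution ::
    "nat \<Rightarrow> nat \<Rightarrow> (nat \<Rightarrow> nat \<Rightarrow> int) \<Rightarrow> (nat \<Rightarrow> nat \<Rightarrow> 'k::field_char_0) \<Rightarrow> (nat \<Rightarrow> nat option) \<Rightarrow>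
     (nat \<Rightarrow> nat \<Rightarrow> 'k) \<Rightarrow> (nat \<Rightarrow> nat \<Rightarrow> int) \<Rightarrow> (nat \<Rightarrow> nat \<Rightarrow> 'k) \<Rightarrow> bool" where
  "GSV_solution n r \<chi> h p q \<chi>y M \<longleftrightarrow>
     M \<in> Mat {1..n} (exchangeable n p) \<and>
     mat_mult {1..n} q M = mat_uminus (Lam_mat n r \<chi> h p) \<and>
     char_row_mult_eq_0 r {1..n} (exchangeable n p) \<chi>y M"

end

(*  The three families of maps involved - the torus action, setting the last variables to zero, and
    the diagonal part of {-, x_k} - all rescale the coefficient of each monomial x^m by a factor that
    is multiplicative or additive in m.  Comparing the coefficients of x_k in {y_i, y_k} gives
    q_{i,k} = q_{i,p(k)} - chi_{y_i}(h_k) for i < k, whence E q E^t = lambda.  The matrix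
    nu + lambda has entries chi_k(h_i), and chi_x = chi_y E^t.  Writing M = E^t N, the equation
    chi_y M = 0 reads chi_x N = 0 and yields nu N = - lambda N = - E q M, so that the equation
    q M = - Lambda becomes nu N = E Lambda.  *)

theory Submission
  imports Defs
begin

section \<open>Rescaling the coefficients of a polynomial\<close>

text \<open>The first equation cannot be solved on its own, because \<open>q\<close> may be
  singular: being skew-symmetric in characteristic 0, it always is when \<open>n\<close> is odd. The
  weight equation removes this obstacle: evaluated at the vectors \<open>h i\<close> it trades
  \<open>q\<close> for the triangular matrix \<nu>, whose diagonal entries are nonzero. Existence
  and uniqueness thus come from the two equations jointly. The formula for E q E^t is derived from
  the recursion for the y_k. The correction term \<delta>_k(y_p(k)) has no influence on it, since it
  contains no x_k. However, reading E by rows presupposes that p takes no finite value twice. This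
  rests on local nilpotency and on characteristic 0, which keeps binomial coefficients nonzero.
  Characteristic 0 enters again with the weights: 2 has infinite order in the multiplicative group,
  so a torus element with one coordinate 2 and all others 1 reveals an integer exponent.\<close>

lemma poly_mapping_single_induct [case_names zero add]:
  assumes "P 0"
    and "\<And>f m a. P f \<Longrightarrow> P (f + Poly_Mapping.single m a)"
  shows "P (f :: 'a \<Rightarrow>\<^sub>0 'b::monoid_add)"
proof (induction f rule: update_induct)
  case const
  show ?case by (fact assms(1))
next
  case (update f m a)
  have "Poly_Mapping.update m a f = f + Poly_Mapping.single m a"
    using update.hyps(1)
    by (intro poly_mapping_eqI) (auto simp: lookup_update lookup_add lookup_single when_def in_keys_iff)
  then show ?case using assms(2)[OF update.IH] by simp
qed

definition twist :: "((nat \<Rightarrow>\<^sub>0 nat) \<Rightarrow> 'k::field_char_0) \<Rightarrow> 'k mpoly \<Rightarrow> 'k mpoly" where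
  "twist c f = Poly_Mapping.mapp (\<lambda>m. (*) (c m)) f"

lemma lookup_twist: "Poly_Mapping.lookup (twist c f) m = c m * Poly_Mapping.lookup f m"
  by (auto simp: twist_def lookup_mapp when_def in_keys_iff)

lemma twist_add: "twist c (f + g) = twist c f + twist c g"
  by (intro poly_mapping_eqI) (simp add: lookup_twist lookup_add algebra_simps)

lemma twist_diff: "twist c (f - g) = twist c f - twist c g"
  by (intro poly_mapping_eqI) (simp add: lookup_twist lookup_minus algebra_simps)

lemma twist_uminus: "twist c (- f) = - twist c f"
  by (intro poly_mapping_eqI) (simp add: lookup_twist)

lemma twist_zero [simp]: "twist c 0 = 0"
  by (intro poly_mapping_eqI) (simp add: lookup_twist)

lemma twist_single: "twist c (Poly_Mapping.single m a) = Poly_Mapping.single m (c m * a)"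
  by (intro poly_mapping_eqI) (simp add: lookup_twist lookup_single when_def)

text \<open>Both sides are biadditive in the two polynomials, which leaves a pair of monomials,
  where the hypothesis is the claim.\<close>

lemma twist_mult:
  assumes "\<And>m m'. c (m + m') = c m * c m'"
  shows "twist c (f * g) = twist c f * twist c g"
proof (induction f rule: poly_mapping_single_induct)
  case (add f m a)
  have "twist c (Poly_Mapping.single m a * g) = twist c (Poly_Mapping.single m a) * twist c g"
    by (induction g rule: poly_mapping_single_induct)
      (simp_all add: distrib_left twist_add mult_single twist_single assms mult_ac)
  then show ?case using add by (simp add: distrib_right twist_add)
qed simp

text \<open>For additive \<open>c\<close> the operator is a weighted Euler derivation: it multiplies
  x_i by the value of \<open>c\<close> at the i-th unit exponent.\<close>

lemma twist_leibniz:
  assumes "\<And>m m'. c (m + m') = c m + c m'"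
  shows "twist c (f * g) = twist c f * g + f * twist c g"
proof (induction f rule: poly_mapping_single_induct)
  case (add f m a)
  have "twist c (Poly_Mapping.single m a * g) =
      twist c (Poly_Mapping.single m a) * g + Poly_Mapping.single m a * twist c g"
    by (induction g rule: poly_mapping_single_induct)
      (simp_all add: distrib_left twist_add mult_single twist_single assms algebra_simps
        flip: single_add)
  then show ?case using add by (simp add: distrib_right distrib_left twist_add)
qed simp

lemma lookup_scalar_mult:
  "Poly_Mapping.lookup (scalar a * f) m = a * Poly_Mapping.lookup f m"
  by (induction f rule: poly_mapping_single_induct)
    (simp_all add: scalar_def distrib_left lookup_add mult_single lookup_single when_def)

lemma twist_eq_scalar_mult:
  assumes "\<And>m. m \<in> Poly_Mapping.keys f \<Longrightarrow> c m = a"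
  shows "twist c f = scalar a * f"
  using assms by (intro poly_mapping_eqI) (auto simp: lookup_twist lookup_scalar_mult in_keys_iff)

section \<open>Polynomial algebras and locally nilpotent derivations\<close>

lemma scalar_0 [simp]: "scalar 0 = 0"
  by (simp add: scalar_def)

lemma scalar_1 [simp]: "scalar 1 = 1"
  by (simp add: scalar_def)

lemma scalar_add: "scalar (a + b) = scalar a + scalar b"
  by (simp add: scalar_def single_add)

lemma scalar_uminus: "scalar (- a) = - scalar a"
  by (simp add: scalar_def single_uminus)

lemma scalar_diff: "scalar (a - b) = scalar a - scalar b"
  by (simp add: scalar_def single_diff)

lemma scalar_eq_iff [simp]: "scalar a = scalar b \<longleftrightarrow> a = b"
  by (metis scalar_def lookup_single_eq)

lemma keys_add_nat: "Poly_Mapping.keys (m + m') = Poly_Mapping.keys m \<union> Poly_Mapping.keys m'"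
  for m m' :: "'a \<Rightarrow>\<^sub>0 nat"
  by (auto simp: in_keys_iff lookup_add)

section \<open>The algebras R_k and induction over their generators\<close>

lemma polys_mono: "f \<in> polys j \<Longrightarrow> j \<le> k \<Longrightarrow> f \<in> polys k"
  unfolding polys_def by fastforce

lemma polys_0 [simp]: "0 \<in> polys k"
  by (simp add: polys_def)

lemma polys_scalar [simp]: "scalar a \<in> polys k"
  by (simp add: polys_def scalar_def)

lemma polys_var: "i \<in> {1..k} \<Longrightarrow> var i \<in> polys k"
  by (simp add: polys_def var_def)

lemma polys_add: "f \<in> polys k \<Longrightarrow> g \<in> polys k \<Longrightarrow> f + g \<in> polys k"
  unfolding polys_def using keys_add[of f g] by blast

lemma polys_mult: "f \<in> polys k \<Longrightarrow> g \<in> polys k \<Longrightarrow> f * g \<in> polys k"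
  unfolding polys_def using keys_mult[of f g] by (fastforce simp: keys_add_nat)

lemma polys_uminus: "f \<in> polys k \<Longrightarrow> - f \<in> polys k"
  by (simp add: polys_def in_keys_iff)

lemma polys_diff: "f \<in> polys k \<Longrightarrow> g \<in> polys k \<Longrightarrow> f - g \<in> polys k"
  using polys_add[of f k "- g"] by (simp add: polys_uminus)

lemma single_polys_induct:
  assumes "\<And>i. i \<in> {1..k} \<Longrightarrow> P (var i)" and "\<And>c. P (scalar c)"
    and "\<And>f g. f \<in> polys k \<Longrightarrow> g \<in> polys k \<Longrightarrow> P f \<Longrightarrow> P g \<Longrightarrow> P (f * g)"
    and "Poly_Mapping.keys m \<subseteq> {1..k}"
  shows "P (Poly_Mapping.single m a)"
  using assms(4)
proof (induction m arbitrary: a rule: update_induct)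
  case const
  then show ?case using assms(2) by (simp add: scalar_def)
next
  case (update m i b)
  have "i \<in> {1..k}"
    using update.prems update.hyps(2) by (simp add: subset_iff in_keys_iff lookup_update)
  have m: "Poly_Mapping.update i b m = m + Poly_Mapping.single i b"
    using update.hyps(1)
    by (intro poly_mapping_eqI) (auto simp: lookup_update lookup_add lookup_single when_def in_keys_iff)
  then have "Poly_Mapping.keys m \<subseteq> {1..k}"
    using update.prems by (simp add: keys_add_nat)
  \<comment> \<open>The hypotheses cover x_i but not its powers, so the exponent of x_i is rebuilt
    from 0, one factor at a time; exponent 0 is the outer induction hypothesis.\<close>
  have "P (Poly_Mapping.single (m + Poly_Mapping.single i b) a)" for b
  proof (induction b)
    case 0
    then show ?case using update.IH[OF \<open>Poly_Mapping.keys m \<subseteq> _\<close>] by simp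
  next
    case (Suc b)
    have "Poly_Mapping.single (m + Poly_Mapping.single i (Suc b)) a =
        Poly_Mapping.single (m + Poly_Mapping.single i b) a * var i"
      by (simp add: var_def mult_single add.assoc flip: single_add)
    moreover have "Poly_Mapping.single (m + Poly_Mapping.single i b) a \<in> polys k"
      using \<open>i \<in> {1..k}\<close> \<open>Poly_Mapping.keys m \<subseteq> _\<close> by (auto simp: polys_def keys_add_nat split: if_splits)
    ultimately show ?case
      using assms(1,3) Suc \<open>i \<in> {1..k}\<close> polys_var by metis
  qed
  then show ?case by (simp add: m)
qed

text \<open>\<open>polys k\<close> is defined by a condition on supports; this rule says that it is
  the algebra generated by x_1, ..., x_k.\<close>

lemma polys_induct [consumes 1, case_names var scalar add mult]:
  assumes "f \<in> polys k"
    and "\<And>i. i \<in> {1..k} \<Longrightarrow> P (var i)" and "\<And>c. P (scalar c)"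
    and "\<And>f g. f \<in> polys k \<Longrightarrow> g \<in> polys k \<Longrightarrow> P f \<Longrightarrow> P g \<Longrightarrow> P (f + g)"
    and "\<And>f g. f \<in> polys k \<Longrightarrow> g \<in> polys k \<Longrightarrow> P f \<Longrightarrow> P g \<Longrightarrow> P (f * g)"
  shows "P f"
  using assms(1)
proof (induction f rule: update_induct)
  case const
  then show ?case using assms(3)[of 0] by simp
next
  case (update f m a)
  have f: "Poly_Mapping.update m a f = f + Poly_Mapping.single m a"
    using update.hyps(1)
    by (intro poly_mapping_eqI) (auto simp: lookup_update lookup_add lookup_single when_def in_keys_iff)
  have m: "Poly_Mapping.keys m \<subseteq> {1..k}"
    using update.prems update.hyps(2) by (auto simp: polys_def in_keys_iff lookup_update)
  have "f \<in> polys k"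
    using update.prems update.hyps(1)
    by (auto simp: polys_def in_keys_iff lookup_update split: if_splits)
  moreover have "Poly_Mapping.single m a \<in> polys k"
    using m by (simp add: polys_def)
  moreover have "P (Poly_Mapping.single m a)"
    using assms(2,3,5) m by (rule single_polys_induct)
  ultimately show ?case using assms(4) update.IH f by simp
qed

text \<open>The values of \<open>D\<close> may leave \<open>polys k\<close>. This matters when
  \<open>D\<close> compares two expressions for the bracket with a variable outside
  \<open>polys k\<close>.\<close>

lemma derivation_eq_0:
  assumes "f \<in> polys k"
    and "\<And>i. i \<in> {1..k} \<Longrightarrow> D (var i) = 0" and "\<And>c. D (scalar c) = 0"
    and "\<And>f g. f \<in> polys k \<Longrightarrow> g \<in> polys k \<Longrightarrow> D (f + g) = D f + D g"
    and "\<And>f g. f \<in> polys k \<Longrightarrow> g \<in> polys k \<Longrightarrow> D (f * g) = D f * g + f * D g"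
  shows "D f = (0 :: 'k::field_char_0 mpoly)"
  using assms(1) by (induction f rule: polys_induct) (simp_all add: assms)

text \<open>The retraction onto R_k that sends every other variable, x_0 included, to 0. It respects
  products because a product of monomials lies in R_k exactly when both factors do.\<close>

definition proj :: "nat \<Rightarrow> 'k::field_char_0 mpoly \<Rightarrow> 'k mpoly" where
  "proj k = twist (\<lambda>m. if Poly_Mapping.keys m \<subseteq> {1..k} then 1 else 0)"

lemma proj_add: "proj k (f + g) = proj k f + proj k g"
  by (simp add: proj_def twist_add)

lemma proj_diff: "proj k (f - g) = proj k f - proj k g"
  by (simp add: proj_def twist_diff)

lemma proj_mult: "proj k (f * g) = proj k f * proj k g"
  unfolding proj_def by (rule twist_mult) (auto simp: keys_add_nat)

lemma proj_in_polys: "proj k f \<in> polys k"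
proof -
  have "Poly_Mapping.keys m \<subseteq> {1..k}" if "m \<in> Poly_Mapping.keys (proj k f)" for m
    using that in_keys_iff[of m "proj k f"] by (auto simp: proj_def lookup_twist split: if_splits)
  then show ?thesis by (simp add: polys_def)
qed

lemma proj_id: "f \<in> polys k \<Longrightarrow> proj k f = f"
  using twist_eq_scalar_mult[of f _ 1] by (auto simp: proj_def polys_def)

lemma proj_var: "i \<notin> {1..k} \<Longrightarrow> proj k (var i) = 0"
  by (auto simp: proj_def var_def twist_single)

lemma var_neq_0 [simp]: "var i \<noteq> 0"
  by (metis var_def lookup_single_eq lookup_zero one_neq_zero)

text \<open>Replaces the notion of a coefficient of x_k: killing x_k isolates the constant term, and
  cancelling x_k in the domain then gives the linear one.\<close>

lemma var_linear_unique:
  fixes a b a' b' :: "'k::field_char_0 mpoly"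
  assumes "a * var k + b = a' * var k + b'"
    and "a \<in> polys (k - 1)" "b \<in> polys (k - 1)" "a' \<in> polys (k - 1)" "b' \<in> polys (k - 1)"
  shows "a = a'" "b = b'"
proof -
  have "proj (k - 1) (a * var k + b) = proj (k - 1) (a' * var k + b')"
    using assms(1) by simp
  moreover have "proj (k - 1) (var k :: 'k mpoly) = 0" by (rule proj_var) auto
  ultimately show "b = b'"
    using assms(2-) by (simp only: proj_add proj_mult proj_id mult_zero_right add_0)
  then show "a = a'" using assms(1) by simp
qed

lemma derivation_on_scalar:
  assumes "derivation_on (polys k) d"
  shows "d (scalar c) = 0"
proof -
  have "d (1 * 1) = d 1 * 1 + 1 * d 1"
    using assms polys_scalar[of 1] unfolding derivation_on_def scalar_1 by blast
  then have "d 1 = 0" by simp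
  moreover have "d (scalar c * 1) = scalar c * d 1"
    using assms polys_scalar[of 1] unfolding derivation_on_def scalar_1 by blast
  ultimately show ?thesis by simp
qed

section \<open>Iterates of a derivation and the degree they define\<close>

lemma funpow_derivation:
  assumes "derivation_on (polys k) d" "f \<in> polys k"
  shows "(d ^^ m) f \<in> polys k"
  using assms by (induction m) (auto simp: derivation_on_def)

lemma funpow_derivation_zero:
  assumes "derivation_on (polys k) d" "(d ^^ m) f = 0" "m \<le> m'"
  shows "(d ^^ m') f = 0"
proof -
  have "d 0 = 0" using derivation_on_scalar[OF assms(1), of 0] by simp
  then have "(d ^^ l) 0 = 0" for l by (induction l) auto
  moreover have "(d ^^ m') f = (d ^^ (m' - m)) ((d ^^ m) f)"
    using assms(3) by (metis comp_apply funpow_add le_add_diff_inverse2)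
  ultimately show ?thesis using assms(2) by simp
qed

lemma funpow_derivation_add:
  assumes "derivation_on (polys k) d" "f \<in> polys k" "g \<in> polys k"
  shows "(d ^^ m) (f + g) = (d ^^ m) f + (d ^^ m) g"
proof (induction m)
  case (Suc m)
  have "d ((d ^^ m) f + (d ^^ m) g) = d ((d ^^ m) f) + d ((d ^^ m) g)"
    using assms funpow_derivation[OF assms(1)] unfolding derivation_on_def by blast
  then show ?case using Suc by simp
qed simp

text \<open>The top-order part of the Leibniz rule; the factor \<open>N\<close> is a binomial coefficient.\<close>

lemma funpow_derivation_mult:
  assumes d: "derivation_on (polys k) d"
  shows "f \<in> polys k \<Longrightarrow> g \<in> polys k \<Longrightarrow> (d ^^ Suc a) f = 0 \<Longrightarrow> (d ^^ Suc b) g = 0 \<Longrightarrow>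
    \<exists>N>0. (d ^^ (a + b)) (f * g) = of_nat N * ((d ^^ a) f * (d ^^ b) g)"
proof (induction "a + b" arbitrary: f g a b)
  case 0
  then show ?case by (auto intro!: exI[of _ 1])
next
  case (Suc l)
  note df = d[unfolded derivation_on_def]
  have [simp]: "d f \<in> polys k" "d g \<in> polys k" using df Suc.prems by auto
  have *: "(d ^^ (a + b)) (f * g) = (d ^^ l) (d f * g) + (d ^^ l) (f * d g)"
    using df Suc.prems Suc.hyps(2)[symmetric]
    by (simp del: funpow.simps add: funpow_Suc_right funpow_derivation_add[OF d] polys_mult)
  have l0: "(d ^^ l) 0 = 0" for l
    using funpow_derivation_zero[OF d, of 0 0] by simp
  \<comment> \<open>This and its mirror image are the two summands of Pascal's rule. A summand may
    vanish only if its own exponent is 0; as \<open>Suc l = a + b\<close>, the exponents are not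
    both 0, so the total factor stays positive.\<close>
  have 1: "\<exists>N. (N > 0 \<or> a = 0) \<and> (d ^^ l) (d f * g) = of_nat N * ((d ^^ a) f * (d ^^ b) g)"
  proof (cases a)
    case 0
    then show ?thesis using Suc.prems l0 by (auto intro!: exI[of _ 0])
  next
    case (Suc a')
    then have "\<exists>N>0. (d ^^ (a' + b)) (d f * g) = of_nat N * ((d ^^ a') (d f) * (d ^^ b) g)"
      using Suc.prems \<open>Suc l = a + b\<close> Suc
      by (intro Suc.hyps(1)) (auto simp del: funpow.simps simp add: funpow_Suc_right)
    then show ?thesis using \<open>Suc l = a + b\<close> Suc
      by (auto simp del: funpow.simps simp add: funpow_Suc_right)
  qed
  have 2: "\<exists>N. (N > 0 \<or> b = 0) \<and> (d ^^ l) (f * d g) = of_nat N * ((d ^^ a) f * (d ^^ b) g)"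
  proof (cases b)
    case 0
    then show ?thesis using Suc.prems l0 by (auto intro!: exI[of _ 0])
  next
    case (Suc b')
    then have "\<exists>N>0. (d ^^ (a + b')) (f * d g) = of_nat N * ((d ^^ a) f * (d ^^ b') (d g))"
      using Suc.prems \<open>Suc l = a + b\<close> Suc
      by (intro Suc.hyps(1)) (auto simp del: funpow.simps simp add: funpow_Suc_right)
    then show ?thesis using \<open>Suc l = a + b\<close> Suc
      by (auto simp del: funpow.simps simp add: funpow_Suc_right)
  qed
  obtain N1 where N1: "N1 > 0 \<or> a = 0" "(d ^^ l) (d f * g) = of_nat N1 * ((d ^^ a) f * (d ^^ b) g)"
    using 1 by blast
  obtain N2 where N2: "N2 > 0 \<or> b = 0" "(d ^^ l) (f * d g) = of_nat N2 * ((d ^^ a) f * (d ^^ b) g)"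
    using 2 by blast
  show ?case
    using N1 N2 * Suc.hyps(2) by (intro exI[of _ "N1 + N2"]) (auto simp: distrib_right)
qed

text \<open>The number \<open>a\<close> is the degree of \<open>f\<close> with respect to the
  locally nilpotent derivation.\<close>

lemma locally_nilpotent_order:
  assumes "derivation_on (polys k) d" "locally_nilpotent_on (polys k) d" "f \<in> polys k" "f \<noteq> 0"
  obtains a where "(d ^^ a) f \<noteq> 0" "(d ^^ Suc a) f = 0"
proof -
  define l where "l = (LEAST l. (d ^^ l) f = 0)"
  have l: "(d ^^ l) f = 0"
    using LeastI_ex[of "\<lambda>l. (d ^^ l) f = 0"] assms(2,3)
    unfolding l_def locally_nilpotent_on_def by blast
  with assms(4) obtain a where a: "l = Suc a" by (cases l) auto
  then have "a < l" by simp
  then have "(d ^^ a) f \<noteq> 0"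
    using not_less_Least[of a "\<lambda>l. (d ^^ l) f = 0"] unfolding l_def by blast
  moreover have "(d ^^ Suc a) f = 0" using l a by (simp only:)
  ultimately show ?thesis by (rule that)
qed

text \<open>In a domain of characteristic 0 this degree is additive on products. If d f were
  nonzero, its degree would be deg f - 1, while f c has degree deg f + deg c.\<close>

lemma locally_nilpotent_eigen:
  assumes d: "derivation_on (polys k) d" "locally_nilpotent_on (polys k) d"
    and "f \<in> polys k" "c \<in> polys k" and eq: "d f = f * c"
  shows "d f = 0"
proof (rule ccontr)
  assume "d f \<noteq> 0"
  then have "f * c \<noteq> 0" by (simp only: eq not_False_eq_True)
  then have "f \<noteq> 0" "c \<noteq> 0" by auto
  obtain a where a: "(d ^^ a) f \<noteq> 0" "(d ^^ Suc a) f = 0"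
    using locally_nilpotent_order[OF d \<open>f \<in> _\<close> \<open>f \<noteq> 0\<close>] .
  obtain b where b: "(d ^^ b) c \<noteq> 0" "(d ^^ Suc b) c = 0"
    using locally_nilpotent_order[OF d \<open>c \<in> _\<close> \<open>c \<noteq> 0\<close>] .
  obtain N where "N > 0" "(d ^^ (a + b)) (f * c) = of_nat N * ((d ^^ a) f * (d ^^ b) c)"
    using funpow_derivation_mult[OF d(1) \<open>f \<in> _\<close> \<open>c \<in> _\<close> a(2) b(2)] by blast
  then have "(d ^^ (a + b)) (f * c) \<noteq> 0" using a(1) b(1) by simp
  moreover have "(d ^^ (a + b)) (f * c) = (d ^^ Suc (a + b)) f"
    by (simp only: funpow_Suc_right comp_apply eq)
  moreover have "(d ^^ Suc (a + b)) f = 0"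
    by (rule funpow_derivation_zero[OF d(1) a(2)]) simp
  ultimately show False by metis
qed

section \<open>Torus weights and brackets with a variable\<close>

lemma derivation_on_closed: "derivation_on S d \<Longrightarrow> f \<in> S \<Longrightarrow> d f \<in> S"
  unfolding derivation_on_def by blast

lemma derivation_onD:
  assumes "derivation_on S d" "f \<in> S" "g \<in> S"
  shows "d (f + g) = d f + d g" "d (scalar c * f) = scalar c * d f"
    "d (f * g) = d f * g + f * d g"
  using assms unfolding derivation_on_def by blast+

lemma two_powi_inject:
  assumes "(2::'k::field_char_0) powi a = 2 powi b"
  shows "a = b"
proof -
  have *: "m = 0" if "(2::'k) ^ m = 1" for m :: nat
  proof -
    have "(of_nat (2 ^ m) :: 'k) = of_nat 1" using that by simp
    then have "2 ^ m = (1::nat)" by (simp only: of_nat_eq_iff)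
    then show ?thesis by simp
  qed
  have "(2::'k) powi (a - b) = 1" "(2::'k) powi (b - a) = 1"
    using assms by (simp_all add: power_int_diff)
  then have "nat (a - b) = 0" "nat (b - a) = 0"
    using * by (metis nat_0_iff nat_le_linear power_int_def linorder_not_le nat_eq_iff order_less_imp_le)+
  then show ?thesis by simp
qed

lemma two_powi_sum:
  "finite I \<Longrightarrow> (\<Prod>i\<in>I. ((2::'k::field_char_0) powi a i) ^ m i) = 2 powi (\<Sum>i\<in>I. int (m i) * a i)"
proof (induction I rule: finite_induct)
  case (insert i I)
  have "((2::'k) powi a i) ^ m i = 2 powi (int (m i) * a i)"
    by (simp add: power_int_power' mult.commute)
  then show ?case using insert by (simp add: power_int_add)
qed simp

context poisson_cgl_extension
begin

section \<open>The bracket on the chain R_1, ..., R_n\<close>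

lemma polys_le: "f \<in> polys k \<Longrightarrow> k \<le> n \<Longrightarrow> f \<in> polys n"
  by (rule polys_mono)

lemma br_derivation: "f \<in> polys n \<Longrightarrow> derivation_on (polys n) (br f)"
  using bracket by (simp add: poisson_bracket_on_def)

lemma br_anticomm: "f \<in> polys n \<Longrightarrow> g \<in> polys n \<Longrightarrow> br f g = - br g f"
  using bracket unfolding poisson_bracket_on_def by blast

lemma br_self: "f \<in> polys n \<Longrightarrow> br f f = 0"
proof -
  assume "f \<in> polys n"
  then have "br f f = - br f f" by (intro br_anticomm)
  then have "2 * br f f = 0" unfolding mult_2 by (metis add.right_inverse)
  then show ?thesis by simp
qed

lemma br_right:
  assumes "f \<in> polys n" "g \<in> polys n" "g' \<in> polys n"
  shows "br f (g + g') = br f g + br f g'"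
    "br f (scalar c * g) = scalar c * br f g" "br f (g * g') = br f g * g' + g * br f g'"
    "br f (scalar c) = 0"
  using derivation_onD[OF br_derivation[OF assms(1)] assms(2,3)]
    derivation_on_scalar[OF br_derivation[OF assms(1)]] by blast+

lemma br_diff_right:
  assumes "f \<in> polys n" "g \<in> polys n" "g' \<in> polys n"
  shows "br f (g - g') = br f g - br f g'"
  using br_right(1)[of f "g - g'" g'] assms by (simp add: polys_diff)

lemma br_left:
  assumes "f \<in> polys n" "f' \<in> polys n" "g \<in> polys n"
  shows "br (f + f') g = br f g + br f' g" "br (f * f') g = br f g * f' + f * br f' g"
    "br (scalar c) g = 0"
proof -
  note [simp] = assms polys_add polys_mult
  show "br (f + f') g = br f g + br f' g"
    using br_anticomm[of "f + f'" g] br_anticomm[of f g] br_anticomm[of f' g] by (simp add: br_right)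
  show "br (f * f') g = br f g * f' + f * br f' g"
    using br_anticomm[of "f * f'" g] br_anticomm[of f g] br_anticomm[of f' g] by (simp add: br_right)
  show "br (scalar c) g = 0"
    using br_anticomm[of "scalar c" g] br_right(4)[of g 0 0] by simp
qed

text \<open>Each R_k is a Poisson subalgebra because brackets of its generators stay inside;
  biderivation rules extend this to all of R_k. The purpose is to know that a bracket of elements of
  R_(k-1) contains no x_k.\<close>

lemma br_polys:
  assumes "k \<le> n" "f \<in> polys k" "g \<in> polys k"
  shows "br f g \<in> polys k"
proof -
  have vars: "br (var i) (var j) \<in> polys k" if ij: "i \<in> {1..k}" "j \<in> {1..k}" "i < j" for i j
  proof -
    have "\<delta> j (var i) \<in> polys (j - 1)"
      by (rule derivation_on_closed[OF \<delta>_derivation]) (use ij assms(1) in \<open>auto intro: polys_var\<close>)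
    then have "\<delta> j (var i) \<in> polys k" using ij by (auto elim: polys_mono)
    then show ?thesis using ij assms(1) bracket_vars[of i j]
      by (auto intro!: polys_diff polys_mult polys_uminus polys_var)
  qed
  have *: "br (var i) g \<in> polys k" if i: "i \<in> {1..k}" for i
    using assms(3)
  proof (induction g rule: polys_induct)
    case (var j)
    have "(var i :: 'k mpoly) \<in> polys n" "(var j :: 'k mpoly) \<in> polys n" 
      using i var assms(1) by (auto intro: polys_var)
    then have "br (var i) (var i) = 0" "br (var i) (var j) = - br (var j) (var i)"
      using br_self br_anticomm by blast+
    then show ?case using vars[of i j] vars[of j i] i var
      by (metis linorder_neqE_nat polys_0 polys_uminus)
  next
    case (scalar c)
    have "(var i :: 'k mpoly) \<in> polys n" using i assms(1) by (auto intro: polys_var)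
    then show ?case using br_right(4)[of "var i" 0 0] by simp
  next
    case (add f g)
    have "(var i :: 'k mpoly) \<in> polys n" using i assms(1) by (auto intro: polys_var)
    then show ?case using add assms(1) by (simp add: br_right polys_le polys_add)
  next
    case (mult f g)
    have "(var i :: 'k mpoly) \<in> polys n" using i assms(1) by (auto intro: polys_var)
    then show ?case using mult assms(1) by (simp add: br_right polys_le polys_add polys_mult)
  qed
  have g: "g \<in> polys n" using assms polys_le by blast
  show ?thesis
    using assms(2)
  proof (induction f rule: polys_induct)
    case (var i)
    then show ?case by (rule *)
  next
    case (scalar c)
    then show ?case using br_left(3)[of 0 0 g] g by simp
  next
    case (add f f')
    then show ?case using br_left(1)[of f f' g] g assms(1) by (simp add: polys_le polys_add)
  next
    case (mult f f')
    then show ?case using br_left(2)[of f f' g] g assms(1,3)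
      by (simp add: polys_le polys_add polys_mult)
  qed
qed

text \<open>Both sides are algebra maps with the same values on the variables. In this form a weight
  can be compared monomial by monomial.\<close>

lemma act_eq_twist:
  assumes t: "t \<in> torus r" and "f \<in> polys n"
  shows "act t f =
    twist (\<lambda>m. \<Prod>i\<in>{1..n}. char_eval r (\<chi> i) t ^ Poly_Mapping.lookup m i) f" (is "_ = twist ?c f")
  using assms(2)
proof (induction f rule: polys_induct)
  note act = act_endo[OF t, unfolded algebra_endomorphism_on_def]
  have *: "?c (m + m') = ?c m * ?c m'" for m m'
    by (simp add: lookup_add power_add prod.distrib)
  {
    case (var i)
    have "?c (Poly_Mapping.single i 1) = (\<Prod>j\<in>{1..n}. if j = i then char_eval r (\<chi> i) t else 1)"
      by (intro prod.cong) (auto simp: lookup_single when_def)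
    also have "\<dots> = char_eval r (\<chi> i) t" using var by simp
    finally have "twist ?c (var i) = scalar (char_eval r (\<chi> i) t) * var i"
      by (intro twist_eq_scalar_mult) (simp add: var_def)
    then show ?case using var_weight[OF var] t by (simp add: weight_vector_def)
  next
    case (scalar a)
    then show ?case using act by (simp add: scalar_def twist_single)
  next
    case (add f g)
    then show ?case using act by (simp add: twist_add)
  next
    case (mult f g)
    then show ?case using act twist_mult[of ?c f g] * by simp
  }
qed

text \<open>Every monomial of a weight vector carries the weight of the vector, so any single
  monomial determines it.\<close>

lemma weight_differential:
  assumes f: "weight_vector r act \<psi> f" "f \<in> polys n" and m: "m \<in> Poly_Mapping.keys f"
  shows "differential r \<psi> H = (\<Sum>i\<in>{1..n}. of_nat (Poly_Mapping.lookup m i) * differential r (\<chi> i) H)"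
proof -
  have \<psi>: "\<psi> l = (\<Sum>i\<in>{1..n}. int (Poly_Mapping.lookup m i) * \<chi> i l)" if l: "l \<in> {1..r}" for l
  proof -
    \<comment> \<open>This one-coordinate element isolates the \<open>l\<close>-th exponent; the
      base 2 has infinite order, so equal powers force equal exponents.\<close>
    define t :: "nat \<Rightarrow> 'k" where "t = (\<lambda>i. if i = l then 2 else 1)"
    have t: "t \<in> torus r" using l by (auto simp: torus_def t_def)
    have "char_eval r \<phi> t = (\<Prod>i\<in>{1..r}. if i = l then 2 powi \<phi> l else 1)" for \<phi>
      unfolding char_eval_def by (intro prod.cong) (auto simp: t_def)
    then have ev: "char_eval r \<phi> t = 2 powi \<phi> l" for \<phi> using l by simp
    have "twist (\<lambda>m. \<Prod>i\<in>{1..n}. char_eval r (\<chi> i) t ^ Poly_Mapping.lookup m i) f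
        = scalar (char_eval r \<psi> t) * f"
      using f t act_eq_twist[OF t f(2)] by (simp add: weight_vector_def)
    then have "(\<Prod>i\<in>{1..n}. char_eval r (\<chi> i) t ^ Poly_Mapping.lookup m i) * Poly_Mapping.lookup f m
        = char_eval r \<psi> t * Poly_Mapping.lookup f m"
      by (metis lookup_twist lookup_scalar_mult)
    then have "(2::'k) powi \<psi> l = 2 powi (\<Sum>i\<in>{1..n}. int (Poly_Mapping.lookup m i) * \<chi> i l)"
      using m by (simp add: ev in_keys_iff two_powi_sum)
    then show ?thesis by (rule two_powi_inject)
  qed
  have "differential r \<psi> H =
      (\<Sum>l\<in>{1..r}. \<Sum>i\<in>{1..n}. of_nat (Poly_Mapping.lookup m i) * (of_int (\<chi> i l) * H l))"
    unfolding differential_def by (intro sum.cong) (simp_all add: \<psi> sum_distrib_right mult.assoc)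
  also have "\<dots> = (\<Sum>i\<in>{1..n}. of_nat (Poly_Mapping.lookup m i) * differential r (\<chi> i) H)"
    by (subst sum.swap) (simp add: differential_def sum_distrib_left)
  finally show ?thesis .
qed

text \<open>Both sides are derivations of R_(k-1) into R as functions of \<open>f\<close>, and they
  agree on the generators by \<open>bracket_vars\<close>. The twist is the derivation x_i \<mapsto>
  -\<chi>_i(h_k) x_i.\<close>

lemma br_var:
  assumes k: "k \<in> {1..n}" and f: "f \<in> polys (k - 1)"
  shows "br f (var k) =
    twist (\<lambda>m. - (\<Sum>i\<in>{1..n}. of_nat (Poly_Mapping.lookup m i) * differential r (\<chi> i) (h k))) f * var k
      - \<delta> k f" (is "_ = twist ?c f * _ - _")
proof -
  define D where "D f = br f (var k) - twist ?c f * var k + \<delta> k f" for f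
  have *: "?c (m + m') = ?c m + ?c m'" for m m'
    by (simp add: lookup_add distrib_right sum.distrib)
  have n: "g \<in> polys (k - 1) \<Longrightarrow> g \<in> polys n" for g :: "'k mpoly" using k by (auto intro: polys_mono)
  have vk: "(var k :: 'k mpoly) \<in> polys n" using k by (rule polys_var)
  note \<delta> = \<delta>_derivation[OF k]
  have "D f = 0"
    using f
  proof (rule derivation_eq_0)
    fix i assume i: "i \<in> {1..k - 1}"
    have "?c (Poly_Mapping.single i 1) = - (\<Sum>j\<in>{1..n}. if j = i then differential r (\<chi> i) (h k) else 0)"
      by (intro arg_cong[of _ _ uminus] sum.cong) (auto simp: lookup_single when_def)
    also have "i \<in> {1..n}" using i k by auto
    then have "- (\<Sum>j\<in>{1..n}. if j = i then differential r (\<chi> i) (h k) else 0)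
        = - differential r (\<chi> i) (h k)" by simp
    finally have "twist ?c (var i) = - scalar (differential r (\<chi> i) (h k)) * var i"
      unfolding scalar_uminus[symmetric] by (intro twist_eq_scalar_mult) (simp add: var_def)
    then show "D (var i) = 0"
      using bracket_vars[of i k] i k by (auto simp: D_def)
  next
    fix c show "D (scalar c) = 0"
      using br_left(3)[OF _ _ vk, of 0 0] derivation_on_scalar[OF \<delta>]
      by (simp add: D_def scalar_def twist_single)
  next
    fix f g :: "'k mpoly" assume "f \<in> polys (k - 1)" "g \<in> polys (k - 1)"
    then show "D (f + g) = D f + D g" "D (f * g) = D f * g + f * D g"
      using br_left(1,2)[OF n n vk] derivation_onD[OF \<delta>] twist_leibniz[of ?c f g] *
      by (simp_all add: D_def twist_add algebra_simps)
  qed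
  then show ?thesis by (simp add: D_def algebra_simps)
qed

lemma br_weight_var:
  assumes "k \<in> {1..n}" "f \<in> polys (k - 1)" "weight_vector r act \<psi> f"
  shows "br f (var k) = scalar (- differential r \<psi> (h k)) * f * var k - \<delta> k f"
proof -
  have "f \<in> polys n" using assms(1,2) by (auto intro: polys_mono)
  then have "twist (\<lambda>m. - (\<Sum>i\<in>{1..n}. of_nat (Poly_Mapping.lookup m i) * differential r (\<chi> i) (h k))) f
      = scalar (- differential r \<psi> (h k)) * f"
    by (intro twist_eq_scalar_mult) (simp only: weight_differential[OF assms(3)])
  then show ?thesis using br_var[OF assms(1,2)] by simp
qed

text \<open>Setting \<open>x\<^sub>k = x\<^sub>k\<^sub>+\<^sub>1 = \<dots> = 0\<close> in \<open>{y, x\<^sub>k} \<in> y R\<^sub>j\<close> shows that \<open>y\<close> divides \<open>\<delta>\<^sub>k(y)\<close>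
  in \<open>R\<^sub>k\<^sub>-\<^sub>1\<close>, which local nilpotency of \<open>\<delta>\<^sub>k\<close> allows only if \<open>\<delta>\<^sub>k(y) = 0\<close>.\<close>

lemma poisson_prime_delta_eq_0:
  assumes k: "k \<in> {1..n}" and y: "y \<in> polys (k - 1)"
    and prime: "poisson_prime_in (polys j) br y" and "k \<le> j"
  shows "\<delta> k y = 0"
proof -
  have "var k \<in> polys j" using k \<open>k \<le> j\<close> by (intro polys_var) auto
  then obtain c where "br y (var k) = y * c"
    using prime unfolding poisson_prime_in_def by blast
  then have "proj (k - 1) (br y (var k)) = proj (k - 1) (y * c)" by simp
  moreover have "\<delta> k y \<in> polys (k - 1)" by (rule derivation_on_closed[OF \<delta>_derivation[OF k] y])
  moreover have "proj (k - 1) (var k :: 'k mpoly) = 0" by (rule proj_var) (use k in auto)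
  ultimately have "- \<delta> k y = y * proj (k - 1) c"
    unfolding br_var[OF k y] by (simp only: proj_diff proj_mult proj_id y) simp
  moreover have "proj (k - 1) (- c) = - proj (k - 1) c" by (simp add: proj_def twist_uminus)
  ultimately have "\<delta> k y = y * proj (k - 1) (- c)" by (metis minus_minus mult_minus_right)
  then show ?thesis
    by (intro locally_nilpotent_eigen[OF \<delta>_derivation[OF k] \<delta>_nilpotent[OF k] y proj_in_polys])
qed

end

section \<open>Matrices\<close>

lemma mat_mult_assoc:
  "mat_mult K (mat_mult J A B) C = mat_mult J A (mat_mult K B C)"
proof (intro ext)
  fix i l
  have "mat_mult K (mat_mult J A B) C i l = (\<Sum>k\<in>K. \<Sum>j\<in>J. A i j * (B j k * C k l))"
    by (simp add: mat_mult_def sum_distrib_right mult.assoc)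
  also have "\<dots> = mat_mult J A (mat_mult K B C) i l"
    by (subst sum.swap) (simp add: mat_mult_def sum_distrib_left)
  finally show "mat_mult K (mat_mult J A B) C i l = mat_mult J A (mat_mult K B C) i l" .
qed

lemma mat_mult_in_Mat: "A \<in> Mat I K \<Longrightarrow> B \<in> Mat K' J \<Longrightarrow> mat_mult L A B \<in> Mat I J"
  by (auto simp: Mat_def mat_mult_def)

lemma mat_one_mult:
  assumes "finite I" "A \<in> Mat I J"
  shows "mat_mult I (mat_one I) A = A"
proof (intro ext)
  fix i k
  have "mat_mult I (mat_one I) A i k = (\<Sum>j\<in>I. if j = i then A i k else 0)"
    unfolding mat_mult_def by (intro sum.cong) (auto simp: mat_one_def)
  then show "mat_mult I (mat_one I) A i k = A i k" using assms by (auto simp: Mat_def)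
qed

lemma mat_mult_one:
  assumes "finite J" "A \<in> Mat I J"
  shows "mat_mult J A (mat_one J) = A"
proof (intro ext)
  fix i k
  have "mat_mult J A (mat_one J) i k = (\<Sum>j\<in>J. if j = k then A i k else 0)"
    unfolding mat_mult_def by (intro sum.cong) (auto simp: mat_one_def)
  then show "mat_mult J A (mat_one J) i k = A i k" using assms by (auto simp: Mat_def)
qed

lemma mat_mult_transpose:
  "mat_mult J (mat_transpose A) (mat_transpose B) = mat_transpose (mat_mult J B A)"
  by (simp add: mat_mult_def mat_transpose_def mult.commute)

lemma mat_transpose_one: "mat_transpose (mat_one I) = mat_one I"
  by (intro ext) (auto simp: mat_transpose_def mat_one_def)

lemma mat_transpose_in_Mat: "A \<in> Mat I J \<Longrightarrow> mat_transpose A \<in> Mat J I"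
  by (auto simp: Mat_def mat_transpose_def)

lemma mat_mult_uminus: "mat_mult J A (mat_uminus B) = mat_uminus (mat_mult J A B)"
  by (intro ext) (simp add: mat_mult_def mat_uminus_def sum_negf)

lemma mat_uminus_uminus: "mat_uminus (mat_uminus A) = A"
  by (simp add: mat_uminus_def)

text \<open>Induction by bordering. Triangularity is required at all indices, so one
  \<open>A\<close> serves for every leading block. The inverse is again triangular, which allows the
  lemma to be applied to it in turn.\<close>

lemma upper_triangular_right_inverse:
  fixes A :: "nat \<Rightarrow> nat \<Rightarrow> 'k::field_char_0"
  assumes upper: "\<And>i j. j < i \<Longrightarrow> A i j = 0" and diag: "\<And>i. i \<in> {1..n} \<Longrightarrow> A i i \<noteq> 0"
  shows "\<exists>B \<in> Mat {1..n} {1..n}. (\<forall>i j. j < i \<longrightarrow> B i j = 0) \<and>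
    (\<forall>i\<in>{1..n}. \<forall>k\<in>{1..n}. mat_mult {1..n} A B i k = (if i = k then 1 else 0))"
  using diag
proof (induction n)
  case 0
  show ?case by (intro bexI[of _ "\<lambda>_ _. 0"]) (auto simp: Mat_def)
next
  case (Suc n)
  then obtain B where B: "B \<in> Mat {1..n} {1..n}" "\<And>i j. j < i \<Longrightarrow> B i j = 0"
    "\<And>i k. i \<in> {1..n} \<Longrightarrow> k \<in> {1..n} \<Longrightarrow> (\<Sum>j\<in>{1..n}. A i j * B j k) = (if i = k then 1 else 0)"
    by (force simp: mat_mult_def)
  define m where "m = Suc n"
  \<comment> \<open>Block inversion: with last column \<open>a\<close> above the corner entry
    \<open>A m m\<close>, the new last column is - B a / \<open>A m m\<close> above 1 /
    \<open>A m m\<close>.\<close>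
  define C where "C i k = (if k \<noteq> m then B i k else if i = m then inverse (A m m)
    else - (\<Sum>l\<in>{1..n}. B i l * A l m) * inverse (A m m))" for i k
  have a: "A m m \<noteq> 0" using Suc.prems by (simp add: m_def)
  have B0: "B i k = 0" if "i \<notin> {1..n} \<or> k \<notin> {1..n}" for i k using B(1) that by (auto simp: Mat_def)
  have split: "(\<Sum>j\<in>{1..m}. f j) = (\<Sum>j\<in>{1..n}. f j) + f m" for f :: "nat \<Rightarrow> 'k"
    by (simp add: m_def)
  have "(\<Sum>j\<in>{1..m}. A i j * C j k) = (if i = k then 1 else 0)"
    if i: "i \<in> {1..m}" and k: "k \<in> {1..m}" for i k
  proof (cases "k = m")
    case False
    then have "k \<in> {1..n}" using k by (auto simp: m_def)
    moreover have "(\<Sum>j\<in>{1..m}. A i j * C j k) = (\<Sum>j\<in>{1..n}. A i j * B j k)"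
      unfolding split using False B0[of m k] by (simp add: C_def m_def)
    moreover have "(\<Sum>j\<in>{1..n}. A m j * B j k) = 0"
      by (intro sum.neutral) (auto simp: upper m_def)
    ultimately show ?thesis using B(3)[of i k] i False by (cases "i = m") (auto simp: m_def)
  next
    case k: True
    show ?thesis
    proof (cases "i = m")
      case True
      have "(\<Sum>j\<in>{1..n}. A m j * C j m) = 0"
        by (intro sum.neutral) (auto simp: upper m_def)
      then show ?thesis unfolding split using True k a by (simp add: C_def)
    next
      case False
      then have i: "i \<in> {1..n}" using i by (auto simp: m_def)
      have "A i j * C j m = - (\<Sum>l\<in>{1..n}. A i j * B j l * A l m) * inverse (A m m)"
        if "j \<in> {1..n}" for j
      proof -
        have "C j m = - (\<Sum>l\<in>{1..n}. B j l * A l m) * inverse (A m m)"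
          using that by (simp add: C_def m_def)
        moreover have "A i j * (\<Sum>l\<in>{1..n}. B j l * A l m) = (\<Sum>l\<in>{1..n}. A i j * B j l * A l m)"
          by (simp add: sum_distrib_left mult.assoc)
        ultimately show ?thesis by (metis mult.assoc mult_minus_right)
      qed
      then have "(\<Sum>j\<in>{1..n}. A i j * C j m) =
          (\<Sum>j\<in>{1..n}. - (\<Sum>l\<in>{1..n}. A i j * B j l * A l m) * inverse (A m m))"
        by (intro sum.cong) auto
      also have "\<dots> = - (\<Sum>j\<in>{1..n}. \<Sum>l\<in>{1..n}. A i j * B j l * A l m) * inverse (A m m)"
        by (simp only: sum_distrib_right[symmetric] sum_negf)
      also have "(\<Sum>j\<in>{1..n}. \<Sum>l\<in>{1..n}. A i j * B j l * A l m) =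
          (\<Sum>l\<in>{1..n}. (\<Sum>j\<in>{1..n}. A i j * B j l) * A l m)"
        by (subst sum.swap) (simp add: sum_distrib_right)
      also have "\<dots> = (\<Sum>l\<in>{1..n}. if i = l then A l m else 0)"
        using B(3)[OF i] by (intro sum.cong) auto
      also have "\<dots> = A i m" using i by simp
      finally show ?thesis unfolding split using False k by (simp add: C_def)
    qed
  qed
  moreover have "C \<in> Mat {1..m} {1..m}"
    using B0 by (auto simp: Mat_def C_def m_def)
  moreover have "C i j = 0" if "j < i" for i j
    using B(2)[OF that] B0[of i] that by (auto simp: C_def m_def)
  ultimately show ?case unfolding m_def[symmetric] mat_mult_def
    by (intro bexI[of _ C]) blast+
qed

text \<open>The condition under the \<open>THE\<close> in \<open>mat_inverse\<close>, named so that
  existence and uniqueness can be stated.\<close>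

definition inverse_mats :: "nat set \<Rightarrow> (nat \<Rightarrow> nat \<Rightarrow> 'k::field_char_0) \<Rightarrow> (nat \<Rightarrow> nat \<Rightarrow> 'k) \<Rightarrow> bool" where
  "inverse_mats I A B \<longleftrightarrow> B \<in> Mat I I \<and> mat_mult I A B = mat_one I \<and> mat_mult I B A = mat_one I"

lemma inverse_mats_mat_inverse:
  assumes "finite I" "A \<in> Mat I I" "inverse_mats I A B"
  shows "inverse_mats I A (mat_inverse I A)"
proof -
  have B: "B \<in> Mat I I" "mat_mult I A B = mat_one I" using assms(3) by (auto simp: inverse_mats_def)
  have "C = B" if "inverse_mats I A C" for C
  proof -
    have C: "C \<in> Mat I I" "mat_mult I C A = mat_one I" using that by (auto simp: inverse_mats_def)
    have "C = mat_mult I (mat_mult I C A) B"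
      unfolding mat_mult_assoc B(2) by (rule mat_mult_one[OF assms(1) C(1), symmetric])
    also have "\<dots> = B" unfolding C(2) by (rule mat_one_mult[OF assms(1) B(1)])
    finally show ?thesis .
  qed
  then show ?thesis
    using assms(3) unfolding mat_inverse_def inverse_mats_def[symmetric] by (metis theI)
qed

text \<open>A right inverse B of A has nonzero diagonal, since its entries there are reciprocal to
  those of A. Hence B has a right inverse C, and A = A (B C) = (A B) C = C makes B
  two-sided.\<close>

lemma upper_triangular_inverse:
  fixes A :: "nat \<Rightarrow> nat \<Rightarrow> 'k::field_char_0"
  assumes A: "A \<in> Mat {1..n} {1..n}" and upper: "\<And>i j. j < i \<Longrightarrow> A i j = 0"
    and diag: "\<And>i. i \<in> {1..n} \<Longrightarrow> A i i \<noteq> 0"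
  shows "\<exists>B. inverse_mats {1..n} A B"
proof -
  let ?I = "{1..n}"
  have *: "mat_mult ?I A B = mat_one ?I"
    if "A \<in> Mat ?I ?I" "B \<in> Mat ?I ?I"
      "\<forall>i\<in>?I. \<forall>k\<in>?I. mat_mult ?I A B i k = (if i = k then 1 else 0)" for A B :: "nat \<Rightarrow> nat \<Rightarrow> 'k"
  proof (intro ext)
    fix i k show "mat_mult ?I A B i k = mat_one ?I i k"
      using mat_mult_in_Mat[OF that(1,2), of ?I] that(3)
      by (cases "i \<in> ?I \<and> k \<in> ?I") (auto simp: Mat_def mat_one_def)
  qed
  obtain B where B: "B \<in> Mat ?I ?I" "\<And>i j. j < i \<Longrightarrow> B i j = 0" "mat_mult ?I A B = mat_one ?I"
    using upper_triangular_right_inverse[of A n, OF upper diag] *[OF A] by blast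
  have "B i i \<noteq> 0" if i: "i \<in> ?I" for i
  proof -
    have "(\<Sum>j\<in>?I. A i j * B j i) = (\<Sum>j\<in>?I. if j = i then A i i * B i i else 0)"
    proof (intro sum.cong refl)
      show "A i j * B j i = (if j = i then A i i * B i i else 0)" for j
        using upper[of j i] B(2)[of i j] by (cases i j rule: linorder_cases) auto
    qed
    then have "mat_mult ?I A B i i = A i i * B i i" using i by (simp add: mat_mult_def)
    then show ?thesis using i unfolding B(3) by (auto simp: mat_one_def)
  qed
  then obtain C where C: "C \<in> Mat ?I ?I" "mat_mult ?I B C = mat_one ?I"
    using upper_triangular_right_inverse[of B n, OF B(2)] *[OF B(1)] by blast
  have "A = mat_mult ?I A (mat_mult ?I B C)" using C A by (simp add: mat_mult_one)
  also have "\<dots> = C" using B(3) C(1) by (simp add: mat_one_mult flip: mat_mult_assoc)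
  finally show ?thesis using B C by (auto simp: inverse_mats_def)
qed

section \<open>The bracket matrix and the weights of the Poisson primes\<close>

lemma lookup_mult_var:
  "Poly_Mapping.lookup (f * var k) (m + Poly_Mapping.single k 1) = Poly_Mapping.lookup f m"
  by (induction f rule: poly_mapping_single_induct)
    (simp_all add: distrib_right lookup_add var_def mult_single lookup_single when_def)

lemma mult_var_add_polys_eq_0:
  assumes "a * var k + b = 0" "a \<in> polys (k - 1)" "b \<in> polys (k - 1)"
  shows "a = 0"
  using var_linear_unique(1)[of a k b 0 0] assms by simp

text \<open>The value of \<open>F\<close> at p(k), with value 0 at -\<infinity>, matching the
  convention that e_(-\<infinity>) = 0.\<close>

definition at_pred :: "(nat \<Rightarrow> nat option) \<Rightarrow> (nat \<Rightarrow> 'a::zero) \<Rightarrow> nat \<Rightarrow> 'a" where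
  "at_pred p F k = (case p k of None \<Rightarrow> 0 | Some j \<Rightarrow> F j)"

locale poisson_cgl_primes = poisson_cgl_extension n r act br \<chi> h \<delta>
  for n r :: nat
    and act :: "(nat \<Rightarrow> 'k::field_char_0) \<Rightarrow> 'k mpoly \<Rightarrow> 'k mpoly"
    and br :: "'k mpoly \<Rightarrow> 'k mpoly \<Rightarrow> 'k mpoly"
    and \<chi> :: "nat \<Rightarrow> nat \<Rightarrow> int"
    and h :: "nat \<Rightarrow> nat \<Rightarrow> 'k"
    and \<delta> :: "nat \<Rightarrow> 'k mpoly \<Rightarrow> 'k mpoly" +
  fixes p :: "nat \<Rightarrow> nat option" and y :: "nat \<Rightarrow> 'k mpoly"
    and \<chi>y :: "nat \<Rightarrow> nat \<Rightarrow> int" and q :: "nat \<Rightarrow> nat \<Rightarrow> 'k"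
  assumes primes: "homogeneous_poisson_primes n r act br \<chi> h \<delta> p y"
    and weights: "weights_of n r act y \<chi>y"
    and bracket_matrix: "bracket_matrix n br y q"
begin

lemma y_cases:
  assumes k: "k \<in> {1..n}"
  obtains (None) "p k = None" "y k = var k" "\<And>f. f \<in> polys (k - 1) \<Longrightarrow> \<delta> k f = 0"
  | (Some) j where "p k = Some j" "j \<in> {1..k - 1}" "y j \<in> polys (k - 1)"
      "poisson_prime_in (polys (k - 1)) br (y j)" "\<delta> k (y j) \<noteq> 0"
      "y k = y j * var k - scalar (inverse (lam r \<chi> h k)) * \<delta> k (y j)"
proof (cases "\<forall>f\<in>polys (k - 1). \<delta> k f = 0")
  case True
  then show ?thesis using primes k None by (auto simp: homogeneous_poisson_primes_def)
next
  case False
  then obtain j where "p k = Some j" "predecessor_candidate r act br \<delta> y k j"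
      "y k = y j * var k - scalar (inverse (lam r \<chi> h k)) * \<delta> k (y j)"
    using bspec[OF primes[unfolded homogeneous_poisson_primes_def] k] by (simp only: if_False) blast
  then show ?thesis
    using Some unfolding predecessor_candidate_def poisson_prime_in_def prime_element_in_def by blast
qed

lemma pred_less: "k \<in> {1..n} \<Longrightarrow> p k = Some j \<Longrightarrow> j \<in> {1..k - 1}"
  by (rule y_cases[of k]) auto

text \<open>If k < k' shared the predecessor j, then y_j would be Poisson prime in R_(k'-1), which
  contains x_k, although \<delta>_k(y_j) is nonzero; \<open>poisson_prime_delta_eq_0\<close> forbids
  this. It makes the \<open>THE\<close> in \<open>successor\<close> meaningful.\<close>

lemma pred_inject:
  assumes k: "k \<in> {1..n}" "p k = Some j" and k': "k' \<in> {1..n}" "p k' = Some j"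
  shows "k = k'"
proof -
  have False if "k < k'" "k \<in> {1..n}" "p k = Some j" "k' \<in> {1..n}" "p k' = Some j" for k k'
  proof -
    have "y j \<in> polys (k - 1)" "\<delta> k (y j) \<noteq> 0"
      using y_cases[OF that(2)] that(3) by (metis option.distinct(1) option.inject)+
    moreover have "poisson_prime_in (polys (k' - 1)) br (y j)"
      using y_cases[OF that(4)] that(5) by (metis option.distinct(1) option.inject)
    moreover have "k \<le> k' - 1" using that(1) by linarith
    ultimately show False
      using poisson_prime_delta_eq_0[of k "y j" "k' - 1"] that(1,2) by auto
  qed
  then show ?thesis using k k' by (metis linorder_neqE_nat)
qed

lemma successor_eq_Some_iff: "successor n p j = Some i \<longleftrightarrow> i \<in> {1..n} \<and> p i = Some j"
proof
  assume i: "i \<in> {1..n} \<and> p i = Some j"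
  then have "(THE k. k \<in> {1..n} \<and> p k = Some j) = i" using pred_inject by blast
  then show "successor n p j = Some i" using i by (auto simp: successor_def)
next
  assume s: "successor n p j = Some i"
  then obtain k where k: "k \<in> {1..n}" "p k = Some j" by (auto simp: successor_def split: if_splits)
  then have "(THE k. k \<in> {1..n} \<and> p k = Some j) = k" using pred_inject by blast
  then show "i \<in> {1..n} \<and> p i = Some j" using s k by (auto simp: successor_def split: if_splits)
qed

lemma y_weight: "k \<in> {1..n} \<Longrightarrow> weight_vector r act (\<chi>y k) (y k)"
  using weights by (simp add: weights_of_def)

lemma y_nonzero: "k \<in> {1..n} \<Longrightarrow> y k \<noteq> 0"
  using y_weight by (auto simp: weight_vector_def)

lemma y_in_polys:
  assumes "k \<in> {1..n}" "k \<le> l"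
  shows "y k \<in> polys l"
proof -
  have v: "(var k :: 'k mpoly) \<in> polys k" using assms(1) by (intro polys_var) auto
  have "y k \<in> polys k"
    using assms(1)
  proof (cases rule: y_cases)
    case None
    then show ?thesis using v by simp
  next
    case (Some j)
    then have "\<delta> k (y j) \<in> polys (k - 1)"
      by (intro derivation_on_closed[OF \<delta>_derivation[OF assms(1)]])
    then have "y j \<in> polys k" "\<delta> k (y j) \<in> polys k" using Some(3) by (auto elim: polys_mono)
    then show ?thesis using v Some(6) by (simp add: polys_diff polys_mult)
  qed
  then show ?thesis using assms(2) by (rule polys_mono)
qed

lemma br_y: "i \<in> {1..n} \<Longrightarrow> j \<in> {1..n} \<Longrightarrow> br (y i) (y j) = scalar (q i j) * y i * y j"
  using bracket_matrix by (simp add: bracket_matrix_def)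

text \<open>The weight is read off one monomial of y_k: x_k times a monomial of y_p(k). It cannot
  cancel, because \<delta>_k(y_p(k)) contains no x_k.\<close>

lemma differential_y:
  assumes k: "k \<in> {1..n}"
  shows "differential r (\<chi>y k) H = at_pred p (\<lambda>j. differential r (\<chi>y j) H) k + differential r (\<chi> k) H"
proof -
  let ?e = "Poly_Mapping.single k (1::nat)"
  let ?w = "\<lambda>m. \<Sum>i\<in>{1..n}. of_nat (Poly_Mapping.lookup m i) * differential r (\<chi> i) H"
  have "?w ?e = (\<Sum>i\<in>{1..n}. if i = k then differential r (\<chi> k) H else 0)"
    by (intro sum.cong) (auto simp: lookup_single when_def)
  then have e: "?w ?e = differential r (\<chi> k) H" using k by simp
  have wk: "m \<in> Poly_Mapping.keys (y k) \<Longrightarrow> differential r (\<chi>y k) H = ?w m" for m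
    using weight_differential[OF y_weight[OF k]] y_in_polys[OF k, of n] k by auto
  show ?thesis
    using k
  proof (cases rule: y_cases)
    case None
    then have "?e \<in> Poly_Mapping.keys (y k)" by (simp add: var_def)
    from wk[OF this] show ?thesis using None(1) e by (simp add: at_pred_def)
  next
    case (Some j)
    have j: "j \<in> {1..n}" using Some(2) k by auto
    obtain m where m: "m \<in> Poly_Mapping.keys (y j)"
      using y_nonzero[OF j] by (metis keys_eq_empty all_not_in_conv)
    have "\<delta> k (y j) \<in> polys (k - 1)"
      using Some(3) by (intro derivation_on_closed[OF \<delta>_derivation[OF k]])
    moreover have "k \<in> Poly_Mapping.keys (m + ?e)" "k \<notin> {1..k - 1}"
      using k by (auto simp: keys_add_nat)
    ultimately have "m + ?e \<notin> Poly_Mapping.keys (\<delta> k (y j))"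
      unfolding polys_def by blast
    then have "Poly_Mapping.lookup (\<delta> k (y j)) (m + ?e) = 0" by (simp only: in_keys_iff) simp
    then have "m + ?e \<in> Poly_Mapping.keys (y k)"
      using m by (simp only: in_keys_iff Some(6) lookup_minus lookup_scalar_mult lookup_mult_var) simp
    from wk[OF this] have "differential r (\<chi>y k) H = ?w m + ?w ?e"
      by (simp add: lookup_add distrib_right sum.distrib)
    moreover have "differential r (\<chi>y j) H = ?w m"
      using weight_differential[OF y_weight[OF j] _ m] y_in_polys[OF j, of n] j by auto
    ultimately show ?thesis using Some(1) e by (simp add: at_pred_def)
  qed
qed

lemma q_skew:
  assumes "i \<in> {1..n}" "j \<in> {1..n}"
  shows "q i j = - q j i"
proof -
  have "y i \<in> polys n" "y j \<in> polys n" using assms y_in_polys by auto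
  then have "br (y i) (y j) = - br (y j) (y i)" by (rule br_anticomm)
  then have "scalar (q i j) * (y i * y j) = scalar (- q j i) * (y i * y j)"
    using assms by (simp add: br_y scalar_uminus mult_ac)
  then show ?thesis using y_nonzero assms by auto
qed

lemma q_pred:
  assumes i: "i \<in> {1..n}" and k: "k \<in> {1..n}" and "i < k"
  shows "q i k = at_pred p (q i) k - differential r (\<chi>y i) (h k)"
proof -
  have yi: "y i \<in> polys (k - 1)" "y i \<in> polys n" "y i \<noteq> 0"
    using y_in_polys[OF i, of "k - 1"] y_in_polys[OF i, of n] y_nonzero[OF i] \<open>i < k\<close> i by auto
  have vk: "(var k :: 'k mpoly) \<in> polys n" using k by (rule polys_var)
  define c where "c = - differential r (\<chi>y i) (h k)"
  note br_var = br_weight_var[OF k yi(1) y_weight[OF i], folded c_def]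
  have \<delta>: "f \<in> polys (k - 1) \<Longrightarrow> \<delta> k f \<in> polys (k - 1)" for f
    by (intro derivation_on_closed[OF \<delta>_derivation[OF k]])
  show ?thesis
    using k
  proof (cases rule: y_cases)
    case None
    then have "scalar (q i k) * y i * var k = scalar c * y i * var k"
      using br_var br_y[OF i k] yi by simp
    then show ?thesis using yi(3) None(1) by (simp add: at_pred_def c_def)
  next
    case (Some j)
    have j: "j \<in> {1..n}" using Some(2) k by auto
    have yj: "y j \<in> polys n" "y j \<noteq> 0" using y_in_polys[OF j, of n] y_nonzero[OF j] j by auto
    define d where "d = scalar (inverse (lam r \<chi> h k)) * \<delta> k (y j)"
    have d: "d \<in> polys (k - 1)" "d \<in> polys n"
      unfolding d_def using \<delta>[OF Some(3)] k by (auto intro!: polys_mult elim: polys_mono)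
    \<comment> \<open>Closure of R_(k-1) under the bracket keeps this term out of the coefficient of
      x_k.\<close>
    have "br (y i) d \<in> polys (k - 1)" using k yi(1) d(1) by (intro br_polys) auto
    have 1: "br (y i) (y j * var k - d)
        = scalar (q i j) * y i * y j * var k + y j * (scalar c * y i * var k - \<delta> k (y i)) - br (y i) d"
      using yi yj vk d by (simp add: br_diff_right br_right polys_mult br_y[OF i j] br_var)
    have 2: "br (y i) (y j * var k - d) = scalar (q i k) * y i * (y j * var k - d)"
      using br_y[OF i k] Some(6) by (simp add: d_def)
    have "(scalar (q i j + c - q i k) * (y i * y j)) * var k +
        (scalar (q i k) * y i * d - y j * \<delta> k (y i) - br (y i) d) = 0"
      using trans[OF 1[symmetric] 2] by (simp add: scalar_add scalar_diff algebra_simps)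
    then have "scalar (q i j + c - q i k) * (y i * y j) = 0"
    proof (rule mult_var_add_polys_eq_0)
      show "scalar (q i j + c - q i k) * (y i * y j) \<in> polys (k - 1)"
        using yi(1) Some(3) by (simp add: polys_mult)
      show "scalar (q i k) * y i * d - y j * \<delta> k (y i) - br (y i) d \<in> polys (k - 1)"
        using \<open>br (y i) d \<in> _\<close> d(1) yi(1) Some(3) \<delta>[OF yi(1)] by (simp add: polys_mult polys_diff)
    qed
    then have "scalar (q i j + c - q i k) = scalar 0" using yi(3) yj(2) by simp
    then show ?thesis using Some(1) unfolding scalar_eq_iff by (simp add: at_pred_def c_def)
  qed
qed

end

section \<open>The GSV equations\<close>

context poisson_cgl_primes
begin

abbreviation mul :: "(nat \<Rightarrow> nat \<Rightarrow> 'k) \<Rightarrow> (nat \<Rightarrow> nat \<Rightarrow> 'k) \<Rightarrow> nat \<Rightarrow> nat \<Rightarrow> 'k" (infixr "\<odot>" 70)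
  where "A \<odot> B \<equiv> mat_mult {1..n} A B"

abbreviation E :: "nat \<Rightarrow> nat \<Rightarrow> 'k" where "E \<equiv> E_mat n p"

abbreviation Et :: "nat \<Rightarrow> nat \<Rightarrow> 'k" where "Et \<equiv> mat_transpose E"

abbreviation \<nu> :: "nat \<Rightarrow> nat \<Rightarrow> 'k" where "\<nu> \<equiv> nu_mat n r \<chi> h"

abbreviation \<Lambda> :: "nat \<Rightarrow> nat \<Rightarrow> 'k" where "\<Lambda> \<equiv> Lam_mat n r \<chi> h p"

abbreviation ex :: "nat set" where "ex \<equiv> exchangeable n p"

text \<open>The columns of E are described by the successor s; its rows are described by p, the form
  suited to the recursion for the y_k.\<close>

lemma E_eq:
  "E i j = (if i \<in> {1..n} \<and> j \<in> {1..n}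
     then (if i = j then 1 else 0) - (if p i = Some j then 1 else 0) else 0)"
  by (simp add: E_mat_def successor_eq_Some_iff)

text \<open>E acts as the difference operator along the chains of p, which is why it undoes the
  recursions for weights and brackets.\<close>

lemma sum_E:
  assumes i: "i \<in> {1..n}"
  shows "(\<Sum>j\<in>{1..n}. E i j * f j) = f i - at_pred p f i"
proof -
  have "(\<Sum>j\<in>{1..n}. E i j * f j) =
      (\<Sum>j\<in>{1..n}. (if j = i then f i else 0) - (if p i = Some j then f j else 0))"
    using i by (intro sum.cong) (auto simp: E_eq)
  also have "\<dots> = f i - (\<Sum>j\<in>{1..n}. if p i = Some j then f j else 0)"
    using i by (simp add: sum_subtractf)
  also have "(\<Sum>j\<in>{1..n}. if p i = Some j then f j else 0) = at_pred p f i"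
  proof (cases "p i")
    case (Some l)
    then show ?thesis using pred_less[OF i Some] i by (auto simp: at_pred_def)
  qed (simp add: at_pred_def)
  finally show ?thesis .
qed

lemma E_in_Mat: "E \<in> Mat {1..n} {1..n}"
  by (auto simp: Mat_def E_mat_def)

lemma q_in_Mat: "q \<in> Mat {1..n} {1..n}"
  using bracket_matrix by (simp add: bracket_matrix_def)

lemma nu_in_Mat: "\<nu> \<in> Mat {1..n} {1..n}"
  by (auto simp: Mat_def nu_mat_def)

lemma Lam_in_Mat: "\<Lambda> \<in> Mat {1..n} ex"
  by (auto simp: Mat_def Lam_mat_def exchangeable_def)

text \<open>As p(k) < k, the transpose of E is upper triangular with unit diagonal. Transposing its
  inverse yields the left inverse of E in the last conclusion.\<close>

lemma E_invertible:
  obtains G where "G \<in> Mat {1..n} {1..n}" "Et \<odot> G = mat_one {1..n}" "G \<odot> Et = mat_one {1..n}"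
    "mat_transpose G \<odot> E = mat_one {1..n}"
proof -
  have "\<exists>G. inverse_mats {1..n} Et G"
  proof (rule upper_triangular_inverse)
    show "Et \<in> Mat {1..n} {1..n}" using E_in_Mat by (rule mat_transpose_in_Mat)
    show "Et i j = 0" if "j < i" for i j
      using pred_less[of j i] that by (auto simp: mat_transpose_def E_eq)
    show "Et i i \<noteq> 0" if "i \<in> {1..n}" for i
      using pred_less[of i i] that by (auto simp: mat_transpose_def E_eq)
  qed
  then obtain G where G: "inverse_mats {1..n} Et G" ..
  then have "mat_transpose G \<odot> mat_transpose Et = mat_one {1..n}"
    by (simp add: mat_mult_transpose inverse_mats_def mat_transpose_one)
  then show ?thesis using that[of G] G by (simp add: inverse_mats_def mat_transpose_def)
qed

lemma nu_inverse: "mat_inverse {1..n} \<nu> \<in> Mat {1..n} {1..n}"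
  "\<nu> \<odot> mat_inverse {1..n} \<nu> = mat_one {1..n}" "mat_inverse {1..n} \<nu> \<odot> \<nu> = mat_one {1..n}"
proof -
  have "\<exists>B. inverse_mats {1..n} \<nu> B"
    by (rule upper_triangular_inverse[OF nu_in_Mat]) (auto simp: nu_mat_def lam_def lam_nonzero)
  then show "mat_inverse {1..n} \<nu> \<in> Mat {1..n} {1..n}"
    "\<nu> \<odot> mat_inverse {1..n} \<nu> = mat_one {1..n}" "mat_inverse {1..n} \<nu> \<odot> \<nu> = mat_one {1..n}"
    using inverse_mats_mat_inverse[OF _ nu_in_Mat] unfolding inverse_mats_def by blast+
qed

text \<open>The known identity q = F \<lambda> F^t with F the inverse of E, solved for \<lambda>;
  the explicit entries are recovered from skewness and the part above the diagonal.\<close>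

definition lambda_mat :: "nat \<Rightarrow> nat \<Rightarrow> 'k" where "lambda_mat = E \<odot> q \<odot> Et"

lemma lambda_in_Mat: "lambda_mat \<in> Mat {1..n} {1..n}"
  unfolding lambda_mat_def
  by (intro mat_mult_in_Mat[OF E_in_Mat mat_mult_in_Mat[OF q_in_Mat mat_transpose_in_Mat[OF E_in_Mat]]])

lemma lambda_skew: "lambda_mat i k = - lambda_mat k i"
proof -
  have "lambda_mat i k = (\<Sum>a\<in>{1..n}. \<Sum>b\<in>{1..n}. E i a * q a b * E k b)" for i k
    by (simp add: lambda_mat_def mat_mult_def mat_transpose_def sum_distrib_left mult.assoc)
  note * = this
  have "lambda_mat k i = (\<Sum>b\<in>{1..n}. \<Sum>a\<in>{1..n}. E k a * q a b * E i b)"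
    unfolding * by (rule sum.swap)
  also have "\<dots> = (\<Sum>b\<in>{1..n}. \<Sum>a\<in>{1..n}. - (E i b * q b a * E k a))"
  proof (intro sum.cong refl)
    fix a b assume "b \<in> {1..n}" "a \<in> {1..n}"
    then show "E k a * q a b * E i b = - (E i b * q b a * E k a)"
      using q_skew[of a b] by simp
  qed
  finally show ?thesis by (simp add: * sum_negf)
qed

lemma lambda_upper:
  assumes i: "i \<in> {1..n}" and k: "k \<in> {1..n}" and "i < k"
  shows "lambda_mat i k = - differential r (\<chi> i) (h k)"
proof -
  have *: "(q \<odot> Et) a k = - differential r (\<chi>y a) (h k)" if "a \<in> {1..n}" "a < k" for a
    using sum_E[OF k, of "q a"] q_pred[OF that(1) k that(2)]
    by (simp add: mat_mult_def mat_transpose_def mult.commute)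
  have "lambda_mat i k = (q \<odot> Et) i k - at_pred p (\<lambda>a. (q \<odot> Et) a k) i"
    using sum_E[OF i, of "\<lambda>a. (q \<odot> Et) a k"] by (simp add: lambda_mat_def mat_mult_def)
  \<comment> \<open>Since p(i) < i < k, the formula for column k also covers row p(i). The remaining
    difference of weights of y_i and y_p(i) is \<chi>_i.\<close>
  also have "at_pred p (\<lambda>a. (q \<odot> Et) a k) i = - at_pred p (\<lambda>a. differential r (\<chi>y a) (h k)) i"
    using * pred_less[OF i] i \<open>i < k\<close> by (auto simp: at_pred_def split: option.split)
  finally show ?thesis using * i \<open>i < k\<close> differential_y[OF i, of "h k"] by simp
qed

lemma nu_eq:
  assumes i: "i \<in> {1..n}" and k: "k \<in> {1..n}"
  shows "\<nu> i k = differential r (\<chi> k) (h i) - lambda_mat i k"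
proof (cases i k rule: linorder_cases)
  case less
  then show ?thesis using lambda_upper[OF i k] i k by (simp add: nu_mat_def)
next
  case equal
  have "2 * lambda_mat k k = 0" using lambda_skew[of k k] unfolding mult_2 by (metis add.right_inverse)
  then show ?thesis using equal k by (simp add: nu_mat_def lam_def)
next
  \<comment> \<open>Below the diagonal \<nu> vanishes, and skewness turns the entry of \<lambda>
    into exactly \<chi>_k(h_i).\<close>
  case greater
  then show ?thesis using lambda_upper[OF k i] lambda_skew[of i k] i k by (simp add: nu_mat_def)
qed

lemma sum_differential:
  "(\<Sum>k\<in>{1..n}. differential r (\<chi> k) H * N k j) = (\<Sum>a\<in>{1..n}. differential r (\<chi>y a) H * (Et \<odot> N) a j)"
proof -
  have "(\<Sum>a\<in>{1..n}. differential r (\<chi>y a) H * (Et \<odot> N) a j)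
      = (\<Sum>a\<in>{1..n}. \<Sum>k\<in>{1..n}. E k a * differential r (\<chi>y a) H * N k j)"
    by (simp add: mat_mult_def mat_transpose_def sum_distrib_left mult_ac)
  also have "\<dots> = (\<Sum>k\<in>{1..n}. (\<Sum>a\<in>{1..n}. E k a * differential r (\<chi>y a) H) * N k j)"
    by (subst sum.swap) (simp add: sum_distrib_right)
  also have "\<dots> = (\<Sum>k\<in>{1..n}. differential r (\<chi> k) H * N k j)"
  proof (intro sum.cong refl)
    fix k assume k: "k \<in> {1..n}"
    show "(\<Sum>a\<in>{1..n}. E k a * differential r (\<chi>y a) H) * N k j = differential r (\<chi> k) H * N k j"
      unfolding sum_E[OF k] using differential_y[OF k, of H] by simp
  qed
  finally show ?thesis ..
qed

lemma char_row_mult_eq_0_Et: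
  "char_row_mult_eq_0 r {1..n} ex \<chi> N \<longleftrightarrow> char_row_mult_eq_0 r {1..n} ex \<chi>y (Et \<odot> N)"
  unfolding char_row_mult_eq_0_def char_row_mult_def sum_differential ..

text \<open>The vanishing of a row of functionals, evaluated at h_i, gives row i of the matrix
  identity.\<close>

lemma nu_mult:
  assumes N: "N \<in> Mat {1..n} ex" and 0: "char_row_mult_eq_0 r {1..n} ex \<chi> N"
  shows "\<nu> \<odot> N = mat_uminus (lambda_mat \<odot> N)"
proof (intro ext)
  fix i j
  show "(\<nu> \<odot> N) i j = mat_uminus (lambda_mat \<odot> N) i j"
  proof (cases "i \<in> {1..n} \<and> j \<in> ex")
    case True
    then have "(\<Sum>k\<in>{1..n}. differential r (\<chi> k) (h i) * N k j) = 0"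
      using 0 h_lie[of i] by (simp add: char_row_mult_eq_0_def char_row_mult_def)
    moreover have "(\<nu> \<odot> N) i j = (\<Sum>k\<in>{1..n}. differential r (\<chi> k) (h i) * N k j - lambda_mat i k * N k j)"
      unfolding mat_mult_def using True by (intro sum.cong) (simp_all add: nu_eq left_diff_distrib)
    ultimately show ?thesis by (simp add: sum_subtractf mat_uminus_def mat_mult_def)
  next
    case False
    then show ?thesis
      using mat_mult_in_Mat[OF nu_in_Mat N, of "{1..n}"] mat_mult_in_Mat[OF lambda_in_Mat N, of "{1..n}"]
      by (simp add: Mat_def mat_uminus_def)
  qed
qed

abbreviation N0 :: "nat \<Rightarrow> nat \<Rightarrow> 'k" where "N0 \<equiv> nu_inv_E_Lam n r \<chi> h p"

lemma E_Lam_in_Mat: "E \<odot> \<Lambda> \<in> Mat {1..n} ex"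
  by (rule mat_mult_in_Mat[OF E_in_Mat Lam_in_Mat])

lemma N0_in_Mat: "N0 \<in> Mat {1..n} ex"
  unfolding nu_inv_E_Lam_def by (rule mat_mult_in_Mat[OF nu_inverse(1) E_Lam_in_Mat])

lemma nu_N0: "\<nu> \<odot> N0 = E \<odot> \<Lambda>"
  unfolding nu_inv_E_Lam_def mat_mult_assoc[symmetric] nu_inverse(2)
  unfolding mat_mult_assoc by (rule mat_one_mult[OF _ E_Lam_in_Mat]) simp

text \<open>Invertibility of E^t makes M = E^t N a mere change of unknown; invertibility of \<nu>
  then leaves a single candidate for N, which inherits the weight condition.\<close>

lemma GSV_solution_unique:
  assumes "GSV_solution n r \<chi> h p q \<chi>y M"
  shows "M = Et \<odot> N0" "char_row_mult_eq_0 r {1..n} ex \<chi> N0"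
proof -
  have M: "M \<in> Mat {1..n} ex" "q \<odot> M = mat_uminus \<Lambda>" "char_row_mult_eq_0 r {1..n} ex \<chi>y M"
    using assms by (auto simp: GSV_solution_def)
  obtain G where G: "G \<in> Mat {1..n} {1..n}" "Et \<odot> G = mat_one {1..n}" "G \<odot> Et = mat_one {1..n}"
    by (rule E_invertible)
  define N where "N = G \<odot> M"
  have N: "N \<in> Mat {1..n} ex" unfolding N_def by (rule mat_mult_in_Mat[OF G(1) M(1)])
  have MN: "M = Et \<odot> N"
    unfolding N_def mat_mult_assoc[symmetric] G(2) by (rule mat_one_mult[OF _ M(1), symmetric]) simp
  have 0: "char_row_mult_eq_0 r {1..n} ex \<chi> N"
    using M(3) unfolding char_row_mult_eq_0_Et MN[symmetric] .
  have "\<nu> \<odot> N = mat_uminus (E \<odot> q \<odot> M)"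
    unfolding nu_mult[OF N 0] lambda_mat_def MN by (simp add: mat_mult_assoc)
  also have "\<dots> = E \<odot> \<Lambda>" by (simp only: M(2) mat_mult_uminus mat_uminus_uminus)
  finally have "mat_inverse {1..n} \<nu> \<odot> \<nu> \<odot> N = N0" by (simp add: nu_inv_E_Lam_def)
  then have "N = N0"
    unfolding mat_mult_assoc[symmetric] nu_inverse(3) using mat_one_mult[OF _ N] by simp
  then show "M = Et \<odot> N0" "char_row_mult_eq_0 r {1..n} ex \<chi> N0" using MN 0 by simp_all
qed

text \<open>The weight condition on \<open>N0\<close> gives E q E^t \<open>N0\<close> = - E
  \<Lambda>, and cancelling E on the left is the remaining step.\<close>

lemma GSV_solution_exists:
  assumes "char_row_mult_eq_0 r {1..n} ex \<chi> N0"
  shows "GSV_solution n r \<chi> h p q \<chi>y (Et \<odot> N0)"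
proof -
  obtain G where G: "mat_transpose G \<odot> E = mat_one {1..n}" by (rule E_invertible)
  have "q \<odot> Et \<odot> N0 \<in> Mat {1..n} ex"
    by (rule mat_mult_in_Mat[OF q_in_Mat mat_mult_in_Mat[OF mat_transpose_in_Mat[OF E_in_Mat] N0_in_Mat]])
  \<comment> \<open>The identity matrix is inserted as G^t E, so that E q E^t appears and the
    leftover G^t later cancels E in front of \<Lambda>.\<close>
  then have "q \<odot> Et \<odot> N0 = (mat_transpose G \<odot> E) \<odot> q \<odot> Et \<odot> N0"
    unfolding G by (rule mat_one_mult[symmetric, rotated]) simp
  also have "\<dots> = mat_transpose G \<odot> lambda_mat \<odot> N0" by (simp add: lambda_mat_def mat_mult_assoc)
  also have "lambda_mat \<odot> N0 = mat_uminus (E \<odot> \<Lambda>)"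
    using nu_mult[OF N0_in_Mat assms] nu_N0 mat_uminus_uminus by metis
  also have "mat_transpose G \<odot> mat_uminus (E \<odot> \<Lambda>) = mat_uminus ((mat_transpose G \<odot> E) \<odot> \<Lambda>)"
    by (simp add: mat_mult_uminus mat_mult_assoc)
  also have "(mat_transpose G \<odot> E) \<odot> \<Lambda> = \<Lambda>"
    unfolding G by (rule mat_one_mult[OF _ Lam_in_Mat]) simp
  finally show ?thesis
    using assms mat_mult_in_Mat[OF mat_transpose_in_Mat[OF E_in_Mat] N0_in_Mat, of "{1..n}"]
    unfolding GSV_solution_def char_row_mult_eq_0_Et[symmetric] by blast
qed

end

theorem corollary3p3p2:
  fixes n r :: nat
    and act :: "(nat \<Rightarrow> 'k::field_char_0) \<Rightarrow> 'k mpoly \<Rightarrow> 'k mpoly"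
    and br :: "'k mpoly \<Rightarrow> 'k mpoly \<Rightarrow> 'k mpoly"
    and \<chi> \<chi>y :: "nat \<Rightarrow> nat \<Rightarrow> int"
    and h q :: "nat \<Rightarrow> nat \<Rightarrow> 'k"
    and \<delta> :: "nat \<Rightarrow> 'k mpoly \<Rightarrow> 'k mpoly"
    and p :: "nat \<Rightarrow> nat option"
    and y :: "nat \<Rightarrow> 'k mpoly"
  assumes "poisson_cgl_extension n r act br \<chi> h \<delta>"
    and "homogeneous_poisson_primes n r act br \<chi> h \<delta> p y"
    and "weights_of n r act y \<chi>y"
    and "bracket_matrix n br y q"
  shows "((\<exists>M. GSV_solution n r \<chi> h p q \<chi>y M) \<longleftrightarrow>
            char_row_mult_eq_0 r {1..n} (exchangeable n p) \<chi> (nu_inv_E_Lam n r \<chi> h p)) \<and>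
         ((\<exists>M. GSV_solution n r \<chi> h p q \<chi>y M) \<longrightarrow>
            (\<exists>!M. GSV_solution n r \<chi> h p q \<chi>y M) \<and>
            GSV_solution n r \<chi> h p q \<chi>y
              (mat_mult {1..n} (mat_transpose (E_mat n p)) (nu_inv_E_Lam n r \<chi> h p)))"
proof -
  interpret poisson_cgl_primes n r act br \<chi> h \<delta> p y \<chi>y q
    using assms unfolding poisson_cgl_primes_def poisson_cgl_primes_axioms_def by blast
  show ?thesis
    using GSV_solution_unique GSV_solution_exists by blast
qed

end
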